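(* Consider two control policies $\pi_\theta$ and $\pi_\phi$, where $\theta,\phi\in\Theta$, in the ride-hailing model described in the context. Then the difference of the objectives of these policies satisfies the following policy improvement bound: $$\begin{aligned}V_\theta(x^{(1,1)})-V_\phi(x^{(1,1)})\ \ge\ &\mathbb E_{x^{(t,i)}\sim\pi_\phi}\left[\sum_{t=1}^{H}\sum_{i=1}^{I_t}\frac{\pi_\theta(a^{(t,i)}|x^{(t,i)})}{\pi_\phi(a^{(t,i)}|x^{(t,i)})}A_\phi(x^{(t,i)},a^{(t,i)})\right]\\ &-\max_{x\in\mathcal X,\,a\in\mathcal A}|A_\phi(x,a)|\ \sum_{t=1}^{H}\sum_{x\in\mathcal X^\Sigma}\mu_\phi(t,x)\sum_{i=1}^{I_t}\sum_{y\in\mathcal X}\left|\xi_\phi(t,i,x,y)-\xi_\theta(t,i,x,y)\right|\\ &-\max_{x\in\mathcal X^\Sigma,\,a\in\mathcal A^\Sigma}|A^\Sigma_\phi(x,a)|\ \sum_{t=1}^{H}\sum_{x\in\mathcal X^\Sigma}\left|\mu_\phi(t,x)-\mu_\theta(t,x)\right|.\end{aligned}$$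
   Context: Ride-hailing model. There are $R$ regions, $N$ cars, decision epochs (minutes) $t=1,\dots,H$, and a patience time of $L$ minutes. In minute $t$ the number of passengers arriving at region $o$ is Poisson with mean $\lambda_o(t)$, all these variables being independent; a passenger arriving at $o$ in minute $t$ travels to $d$ with probability $P_{od}(t)$; a trip from $o$ to $d$ initiated at time $t$ has deterministic duration $\tau_{od}(t)$. Put $\tau_d=\max_{t,o}\tau_{od}(t)$; it is assumed that $L<\min_{t,o}\tau_{od}(t)$ for every $d$. MDP (finite horizon, undiscounted): a state at epoch $t$ is $x^{(t)}=[x_e^{(t)},x_c^{(t)},x_p^{(t)}]\in\mathcal X^\Sigma$, where $x^{(t)}_e=t$, $x^{(t)}_c(d,\eta)$ is the number of cars with final destination $d$ and total remaining travel time $\eta\in\{0,1,\dots,\tau_d+L\}$, and $x^{(t)}_p(o,d)$ is the number of passengers requesting a ride from $o$ to $d$. A car is available if its remaining travel time is at most $L$; $I_t=\sum_{o=1}^R\sum_{\eta=0}^L x_c^{(t)}(o,\eta)$ is the number of available cars at epoch $t$. An action is $a^{(t)}=(a^{(t,1)},\dots,a^{(t,I_t)})\in\mathcal A^\Sigma$, where each atomic action $a^{(t,i)}$ lies in $\mathcal A=\{(o,d)\}_{o,d=1}^R$. Sequential decision making (SDM) process: its states $x^{(t,i)}=[x_e,x_c,x_p,x_\ell]\in\mathcal X$ (the state after $i-1$ steps at epoch $t$) have an additional component $x_\ell(d,\eta)$ ($d=1,\dots,R$, $\eta=0,\dots,L$) counting the cars assigned "do nothing" in the current epoch; $x^{(t,1)}$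 is $x^{(t)}$ with $x_\ell=0$. Atomic action $(o,d)$ is feasible if there is an available car at most $L$ minutes away from $o$; the closest such available car takes the trip. If a passenger requests a ride from $o$ to $d$, the car is matched with such a passenger (car-passenger matching); otherwise, if $d\ne o$, it is an empty-car routing; otherwise ($d=o$) it is a do-nothing action. A matched or routed car becomes associated with its new final destination $d$ (and hence is no longer available); a do-nothing car is recorded in $x_\ell$ and excluded from the available cars until the next epoch. Transitions within the SDM process are deterministic given the atomic action, and the process stops after $I_t$ steps, when no available car remains. Then the system moves to $x^{(t+1)}$ according to the dynamics of the original MDP: passengers who have not been matched leave and new passengers arrive. $\mathcal P(x,a,y)$ denotes the probability that the next epoch starts in state $y$ given that the last SDM state and atomic action of the current epoch are $x,a$. One-step reward: $g(x^{(t,i)},a^{(t,i)})$ equals $g_f^{(t)}(o,d,\eta)$ for a car-passenger matching ($\eta$ the distance in minutes between the matched car and the passenger), $-g_e^{(t)}(o,d)$ for an empty-car routing, and $0$ for a do-nothing action. Policies: $\{\pi_\theta:\theta\in\Theta\}$, $\Theta$ an open subset of $\mathbb R^d$, $d\ge1$, is a set of parametrized randomized control policies; $\pi_\theta(a|x)$ is the probability of choosing atomic action $a\in\mathcal A$ at SDM state $x\in\mathcal X$, with $\pi_\theta(a|x)=0$ if $a$ is infeasible at $x$; in the SDM process $a^{(t,i)}$ is sampled from $\pi_\theta(\cdot|x^{(t,i)})$. $\mathbb E_\pi$ and $\mathbb P$ refer to the process run under the indicated policy. Value function: $V_\theta(x^{(t,i)})=\mathbb E_{\pi_\theta}\big[\sum_{k=i}^{I_t}g(x^{(t,k)},a^{(t,k)})+\sum_{j=t+1}^H\sum_{k=1}^{I_j}g(x^{(j,k)},a^{(j,k)})\big]$,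 and $V_\theta(x^{(H+1,1)})=0$. Advantage function: $A_\theta(x^{(t,i)},a^{(t,i)})=g(x^{(t,i)},a^{(t,i)})+V_\theta(x^{(t,i+1)})-V_\theta(x^{(t,i)})$ if $i\ne I_t$, and $A_\theta(x^{(t,i)},a^{(t,i)})=g(x^{(t,i)},a^{(t,i)})+\sum_{y\in\mathcal X}\mathcal P(x^{(t,i)},a^{(t,i)},y)V_\theta(y)-V_\theta(x^{(t,i)})$ if $i=I_t$. Advantage function of the original MDP: $A_\theta^\Sigma(x^{(t)},a^{(t)})=\sum_{i=1}^{I_t}A_\theta(x^{(t,i)},a^{(t,i)})$ for $x^{(t)}\in\mathcal X^\Sigma$ and $a^{(t)}=(a^{(t,1)},\dots,a^{(t,I_t)})\in\mathcal A^\Sigma$. Occupation measures: $\mu_\theta(t,x)=\mathbb P(x^{(t)}=x)$ for $x\in\mathcal X^\Sigma$, where $x^{(t)}$ is the state of the MDP at epoch $t$ when actions are generated by the SDM process under $\pi_\theta$; $\xi_\theta(t,i,x,y)=\mathbb P(x^{(t,i)}=y\mid x^{(t,1)}=x)$ under $\pi_\theta$, for $x\in\mathcal X^\Sigma$, $y\in\mathcal X$, $i=1,\dots,I_t$, i.e. the probability that the SDM process started at $x$ at epoch $t$ is at $y$ after $i-1$ steps.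
   Formalization: Adds the assumption that, at every SDM state visited under π_φ, π_φ(a|x)=0 implies π_θ(a|x)=0; without it the bound fails (H=N=1, π_φ always does nothing, π_θ always routes the empty car at positive cost). *)

theory Defs
  imports "HOL-Probability.Probability"
begin

section \<open>Model primitives\<close>

text \<open>
  Regions are the elements of a finite type \<open>'r\<close>, so \<open>R = CARD('r)\<close>. All times are in whole
  minutes. Only the values of the time-dependent parameters at \<open>t = 1, \<dots>, H\<close> matter.
\<close>

record 'r ride_model =
  horizon :: nat                                    \<comment> \<open>\<open>H\<close>\<close>
  patience :: nat                                   \<comment> \<open>\<open>L\<close>\<close>
  num_cars :: nat                                   \<comment> \<open>\<open>N\<close>\<close>
  arrival_rate :: "nat \<Rightarrow> 'r \<Rightarrow> real"             \<comment> \<open>\<open>\<lambda>\<^sub>o(t)\<close>, arguments \<open>t o\<close>\<close>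
  dest_dist :: "nat \<Rightarrow> 'r \<Rightarrow> 'r pmf"              \<comment> \<open>\<open>P\<^sub>o\<^sub>d(t) = pmf (dest_dist t o) d\<close>\<close>
  travel_time :: "nat \<Rightarrow> 'r \<Rightarrow> 'r \<Rightarrow> nat"          \<comment> \<open>\<open>\<tau>\<^sub>o\<^sub>d(t)\<close>, arguments \<open>t o d\<close>\<close>
  match_reward :: "nat \<Rightarrow> 'r \<Rightarrow> 'r \<Rightarrow> nat \<Rightarrow> real" \<comment> \<open>\<open>g\<^sub>f\<^sup>(\<^sup>t\<^sup>)(o,d,\<eta>)\<close>\<close>
  empty_cost :: "nat \<Rightarrow> 'r \<Rightarrow> 'r \<Rightarrow> real"          \<comment> \<open>\<open>g\<^sub>e\<^sup>(\<^sup>t\<^sup>)(o,d)\<close>\<close>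

definition valid_model :: "('r::finite) ride_model \<Rightarrow> bool" where
  "valid_model M \<longleftrightarrow>
     horizon M \<ge> 1 \<and> num_cars M \<ge> 1 \<and>
     (\<forall>t\<in>{1..horizon M}. \<forall>orig. arrival_rate M t orig \<ge> 0) \<and>
     (\<forall>t\<in>{1..horizon M}. \<forall>orig d. patience M < travel_time M t orig d)"

definition max_travel_time :: "('r::finite) ride_model \<Rightarrow> 'r \<Rightarrow> nat" where
  "max_travel_time M d = Max {travel_time M t orig d | t orig. t \<in> {1..horizon M}}"


section \<open>States and actions\<close>

record 'r mdp_state =
  epoch :: nat
  cars :: "'r \<Rightarrow> nat \<Rightarrow> nat"
  passengers :: "'r \<Rightarrow> 'r \<Rightarrow> nat"

record 'r sdm_state = "'r mdp_state" +
  idle :: "'r \<Rightarrow> nat \<Rightarrow> nat"       \<comment> \<open>\<open>x\<^sub>\<ell>\<close>; such cars are removed from the field \<open>cars\<close>\<close>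

type_synonym 'r action = "'r \<times> 'r"

type_synonym 'r policy = "'r sdm_state \<Rightarrow> 'r action pmf"

definition start :: "'r mdp_state \<Rightarrow> 'r sdm_state" where
  "start x = \<lparr>epoch = epoch x, cars = cars x, passengers = passengers x, idle = (\<lambda>_ _. 0)\<rparr>"

text \<open>
  Epoch \<open>H + 1\<close> is the terminal one. Car counts are total functions that vanish outside the index
  range of the model.
\<close>

definition mdp_states :: "('r::finite) ride_model \<Rightarrow> 'r mdp_state set" where
  "mdp_states M =
     {x. epoch x \<in> {1..horizon M + 1} \<and>
         (\<forall>d \<eta>. \<eta> > max_travel_time M d + patience M \<longrightarrow> cars x d \<eta> = 0) \<and>
         (\<Sum>d\<in>UNIV. \<Sum>\<eta>\<le>max_travel_time M d + patience M. cars x d \<eta>) = num_cars M}"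

definition sdm_states :: "('r::finite) ride_model \<Rightarrow> 'r sdm_state set" where
  "sdm_states M =
     {x. epoch x \<in> {1..horizon M + 1} \<and>
         (\<forall>d \<eta>. \<eta> > max_travel_time M d + patience M \<longrightarrow> cars x d \<eta> = 0) \<and>
         (\<forall>d \<eta>. \<eta> > patience M \<longrightarrow> idle x d \<eta> = 0) \<and>
         (\<Sum>d\<in>UNIV. \<Sum>\<eta>\<le>max_travel_time M d + patience M. cars x d \<eta>)
           + (\<Sum>d\<in>UNIV. \<Sum>\<eta>\<le>patience M. idle x d \<eta>) = num_cars M}"

text \<open>
  At the beginning of epoch \<open>t\<close> this is \<open>I\<^sub>t\<close>; after \<open>i - 1\<close> feasible atomic actions it is the
  number \<open>I\<^sub>t - i + 1\<close> of atomic actions still to be taken.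
\<close>

definition available :: "('r::finite) ride_model \<Rightarrow> 'r sdm_state \<Rightarrow> nat" where
  "available M x = (\<Sum>orig\<in>UNIV. \<Sum>\<eta>\<le>patience M. cars x orig \<eta>)"

text \<open>
  A car heading to \<open>d \<noteq> o\<close> first completes its trip and is then more than \<open>L\<close> minutes away from
  \<open>o\<close>, since every trip takes more than \<open>L\<close> minutes. So the available cars at most \<open>L\<close> minutes
  away from \<open>o\<close> are those with final destination \<open>o\<close> and remaining travel time \<open>\<eta> \<le> L\<close>, and
  \<open>\<eta>\<close> is their distance to \<open>o\<close>. No decisions are made at the terminal epoch.
\<close>

definition feasible :: "'r ride_model \<Rightarrow> 'r sdm_state \<Rightarrow> 'r action \<Rightarrow> bool" where
  "feasible M x a \<longleftrightarrow>
     epoch x \<in> {1..horizon M} \<and> (\<exists>\<eta>\<le>patience M. cars x (fst a) \<eta> > 0)"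

definition closest :: "'r sdm_state \<Rightarrow> 'r \<Rightarrow> nat" where
  "closest x orig = (LEAST \<eta>. cars x orig \<eta> > 0)"


section \<open>Dynamics and rewards\<close>

definition add_count :: "'r \<Rightarrow> nat \<Rightarrow> ('r \<Rightarrow> nat \<Rightarrow> nat) \<Rightarrow> 'r \<Rightarrow> nat \<Rightarrow> nat" where
  "add_count d \<eta> c = c(d := (c d)(\<eta> := c d \<eta> + 1))"

definition remove_count :: "'r \<Rightarrow> nat \<Rightarrow> ('r \<Rightarrow> nat \<Rightarrow> nat) \<Rightarrow> 'r \<Rightarrow> nat \<Rightarrow> nat" where
  "remove_count d \<eta> c = c(d := (c d)(\<eta> := c d \<eta> - 1))"

text \<open>
  The car taking the trip from \<open>o\<close> to \<open>d\<close> first spends its remaining \<open>\<eta>\<close> minutes to reach \<open>o\<close>,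
  so its total remaining travel time becomes \<open>\<eta> + \<tau>\<^sub>o\<^sub>d(t)\<close>. The values at infeasible actions are
  irrelevant.
\<close>

definition atomic_step :: "'r ride_model \<Rightarrow> 'r sdm_state \<Rightarrow> 'r action \<Rightarrow> 'r sdm_state" where
  "atomic_step M x a = (case a of (orig, d) \<Rightarrow>
     let \<eta> = closest x orig;
         moved = add_count d (\<eta> + travel_time M (epoch x) orig d) (remove_count orig \<eta> (cars x))
     in if passengers x orig d > 0 then
          x\<lparr>cars := moved,
            passengers := (passengers x)(orig := (passengers x orig)(d := passengers x orig d - 1))\<rparr>
        else if d \<noteq> orig then x\<lparr>cars := moved\<rparr>
        else x\<lparr>cars := remove_count orig \<eta> (cars x), idle := add_count orig \<eta> (idle x)\<rparr>)"

definition reward :: "'r ride_model \<Rightarrow> 'r sdm_state \<Rightarrow> 'r action \<Rightarrow> real" where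
  "reward M x a = (case a of (orig, d) \<Rightarrow>
     if passengers x orig d > 0 then match_reward M (epoch x) orig d (closest x orig)
     else if d \<noteq> orig then - empty_cost M (epoch x) orig d
     else 0)"

text \<open>\<open>poisson_pmf\<close> is only specified for positive rates.\<close>

definition arrival_count :: "real \<Rightarrow> nat pmf" where
  "arrival_count r = (if r > 0 then poisson_pmf r else return_pmf 0)"

definition new_passengers :: "('r::finite) ride_model \<Rightarrow> nat \<Rightarrow> ('r \<Rightarrow> 'r \<Rightarrow> nat) pmf" where
  "new_passengers M t = Pi_pmf UNIV (\<lambda>_. 0)
     (\<lambda>orig. do {n \<leftarrow> arrival_count (arrival_rate M t orig);
               ds \<leftarrow> replicate_pmf n (dest_dist M t orig);
               return_pmf (count_list ds)})"

text \<open>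
  From the SDM state reached after the last atomic action to the next epoch: do-nothing cars rejoin
  the others, all remaining travel times decrease by one minute (staying at 0 once there), and the
  passengers are those arriving in minute \<open>t + 1\<close>. The passengers at the terminal epoch play no role.
\<close>

definition next_cars :: "'r sdm_state \<Rightarrow> 'r \<Rightarrow> nat \<Rightarrow> nat" where
  "next_cars x d \<eta> =
     (let c = (\<lambda>\<eta>. cars x d \<eta> + idle x d \<eta>)
      in if \<eta> = 0 then c 0 + c 1 else c (\<eta> + 1))"

definition next_epoch :: "('r::finite) ride_model \<Rightarrow> 'r sdm_state \<Rightarrow> 'r mdp_state pmf" where
  "next_epoch M x =
     map_pmf (\<lambda>p. \<lparr>epoch = epoch x + 1, cars = next_cars x, passengers = p\<rparr>)
       (new_passengers M (epoch x + 1))"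

text \<open>The transition probability \<open>\<P>(x,a,y)\<close>; \<open>y\<close> is the first SDM state of the next epoch.\<close>

definition trans_prob :: "('r::finite) ride_model \<Rightarrow> 'r sdm_state \<Rightarrow> 'r action \<Rightarrow> 'r sdm_state \<Rightarrow> real"
  where "trans_prob M x a y = pmf (map_pmf start (next_epoch M (atomic_step M x a))) y"


section \<open>Policies and the controlled process\<close>

text \<open>
  The support condition is imposed only where a feasible action exists: a policy is never consulted
  at the other states.
\<close>

definition admissible_policy :: "('r::finite) ride_model \<Rightarrow> 'r policy \<Rightarrow> bool" where
  "admissible_policy M p \<longleftrightarrow>
     (\<forall>x\<in>sdm_states M. (\<exists>a. feasible M x a) \<longrightarrow> (\<forall>a. \<not> feasible M x a \<longrightarrow> pmf (p x) a = 0))"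

text \<open>
  \<open>sdm_at M x as i\<close> is the SDM state \<open>x\<^sup>(\<^sup>t\<^sup>,\<^sup>i\<^sup>)\<close> when \<open>x\<close> is the SDM state at step 1 and \<open>as\<close> the list
  of atomic actions; the \<open>i\<close>-th atomic action is \<open>as ! (i - 1)\<close>.
\<close>

definition sdm_at :: "'r ride_model \<Rightarrow> 'r sdm_state \<Rightarrow> 'r action list \<Rightarrow> nat \<Rightarrow> 'r sdm_state" where
  "sdm_at M x as i = foldl (atomic_step M) x (take (i - 1) as)"

text \<open>The first \<open>k\<close> atomic actions sampled by the SDM process started at \<open>x\<close>.\<close>

primrec sample_actions ::
    "'r ride_model \<Rightarrow> 'r policy \<Rightarrow> nat \<Rightarrow> 'r sdm_state \<Rightarrow> 'r action list pmf" where
  "sample_actions M p 0 x = return_pmf []"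
| "sample_actions M p (Suc k) x =
     do {a \<leftarrow> p x; as \<leftarrow> sample_actions M p k (atomic_step M x a); return_pmf (a # as)}"

text \<open>
  A trajectory lists, for each consecutive epoch, the SDM state from which the epoch is run and the
  atomic actions taken from there. \<open>run M p n x\<close> is the law of the trajectory over \<open>n\<close> epochs
  (the current one included) started at the SDM state \<open>x\<close>, which may lie in the middle of an epoch.
\<close>

type_synonym 'r trajectory = "('r sdm_state \<times> 'r action list) list"

primrec run ::
    "('r::finite) ride_model \<Rightarrow> 'r policy \<Rightarrow> nat \<Rightarrow> 'r sdm_state \<Rightarrow> 'r trajectory pmf" where
  "run M p 0 x = return_pmf []"
| "run M p (Suc n) x =
     do {as \<leftarrow> sample_actions M p (available M x) x;
         y \<leftarrow> next_epoch M (foldl (atomic_step M) x as);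
         \<omega> \<leftarrow> run M p n (start y);
         return_pmf ((x, as) # \<omega>)}"

text \<open>
  For a trajectory started at epoch 1: \<open>x\<^sup>(\<^sup>t\<^sup>,\<^sup>1\<^sup>)\<close>, \<open>I\<^sub>t\<close>, \<open>x\<^sup>(\<^sup>t\<^sup>,\<^sup>i\<^sup>)\<close> and \<open>a\<^sup>(\<^sup>t\<^sup>,\<^sup>i\<^sup>)\<close>.
\<close>

definition traj_start :: "'r trajectory \<Rightarrow> nat \<Rightarrow> 'r sdm_state" where
  "traj_start \<omega> t = fst (\<omega> ! (t - 1))"

definition traj_steps :: "('r::finite) ride_model \<Rightarrow> 'r trajectory \<Rightarrow> nat \<Rightarrow> nat" where
  "traj_steps M \<omega> t = available M (traj_start \<omega> t)"

definition traj_state :: "'r ride_model \<Rightarrow> 'r trajectory \<Rightarrow> nat \<Rightarrow> nat \<Rightarrow> 'r sdm_state" where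
  "traj_state M \<omega> t i = sdm_at M (traj_start \<omega> t) (snd (\<omega> ! (t - 1))) i"

definition traj_action :: "'r trajectory \<Rightarrow> nat \<Rightarrow> nat \<Rightarrow> 'r action" where
  "traj_action \<omega> t i = snd (\<omega> ! (t - 1)) ! (i - 1)"


section \<open>Value and advantage functions\<close>

definition total_reward :: "'r ride_model \<Rightarrow> 'r trajectory \<Rightarrow> real" where
  "total_reward M \<omega> = (\<Sum>(x, as)\<leftarrow>\<omega>. \<Sum>i=1..length as. reward M (sdm_at M x as i) (as ! (i - 1)))"

text \<open>At the terminal epoch \<open>H + 1\<close> the trajectory is empty and the value is 0.\<close>

definition value_fun :: "('r::finite) ride_model \<Rightarrow> 'r policy \<Rightarrow> 'r sdm_state \<Rightarrow> real" where
  "value_fun M p x =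
     measure_pmf.expectation (run M p (horizon M + 1 - epoch x) x) (total_reward M)"

text \<open>The case distinction \<open>i \<noteq> I\<^sub>t\<close> says that more than one available car is left.\<close>

definition advantage :: "('r::finite) ride_model \<Rightarrow> 'r policy \<Rightarrow> 'r sdm_state \<Rightarrow> 'r action \<Rightarrow> real"
  where
  "advantage M p x a =
     (if available M x > 1
      then reward M x a + value_fun M p (atomic_step M x a) - value_fun M p x
      else reward M x a
           + (\<Sum>\<^sub>\<infinity>y\<in>sdm_states M. trans_prob M x a y * value_fun M p y) - value_fun M p x)"

definition mdp_advantage ::
    "('r::finite) ride_model \<Rightarrow> 'r policy \<Rightarrow> 'r mdp_state \<Rightarrow> 'r action list \<Rightarrow> real" where
  "mdp_advantage M p x as =
     (\<Sum>i=1..available M (start x). advantage M p (sdm_at M (start x) as i) (as ! (i - 1)))"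

text \<open>
  The state-action pairs over which the two maxima range: the advantage functions are only defined
  at feasible actions.
\<close>

definition sdm_pairs :: "('r::finite) ride_model \<Rightarrow> ('r sdm_state \<times> 'r action) set" where
  "sdm_pairs M = {(x, a). x \<in> sdm_states M \<and> feasible M x a}"

definition mdp_pairs :: "('r::finite) ride_model \<Rightarrow> ('r mdp_state \<times> 'r action list) set" where
  "mdp_pairs M =
     {(x, as). x \<in> mdp_states M \<and> epoch x \<le> horizon M \<and> length as = available M (start x) \<and>
        (\<forall>i\<in>{1..length as}. feasible M (sdm_at M (start x) as i) (as ! (i - 1)))}"


section \<open>Occupation measures\<close>

definition occ_mdp ::
    "('r::finite) ride_model \<Rightarrow> 'r policy \<Rightarrow> 'r mdp_state \<Rightarrow> nat \<Rightarrow> 'r mdp_state \<Rightarrow> real" where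
  "occ_mdp M p x1 t x =
     measure_pmf.prob (run M p (horizon M) (start x1)) {\<omega>. traj_start \<omega> t = start x}"

text \<open>
  The conditional law given \<open>x\<^sup>(\<^sup>t\<^sup>,\<^sup>1\<^sup>) = x\<close> is that of the SDM process started at \<open>x\<close>. The epoch is a
  component of \<open>x\<close>, so only \<open>t = epoch x\<close> is meaningful.
\<close>

definition occ_sdm ::
    "('r::finite) ride_model \<Rightarrow> 'r policy \<Rightarrow> nat \<Rightarrow> nat \<Rightarrow> 'r mdp_state \<Rightarrow> 'r sdm_state \<Rightarrow> real" where
  "occ_sdm M p t i x y =
     (if epoch x = t
      then measure_pmf.prob (sample_actions M p (available M (start x)) (start x))
             {as. sdm_at M (start x) as i = y}
      else 0)"

end

theory Submission
  imports Defs
begin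

text \<open>
  Telescoping the advantages along an epoch and then along the epochs gives the performance difference
  identity \<open>V\<^sub>\<theta> - V\<^sub>\<phi> = \<Sum>\<^sub>t E F(x\<^sup>(\<^sup>t\<^sup>))\<close>, where \<open>x\<^sup>(\<^sup>t\<^sup>)\<close> has the law \<open>\<mu>\<^sub>\<theta>(t, \<cdot>)\<close> and \<open>F(x)\<close> is the mean of
  \<open>A\<^sub>\<phi>\<^sup>\<Sigma>(x, \<cdot>)\<close> under \<open>\<pi>\<^sub>\<theta>\<close>. Replacing \<open>\<mu>\<^sub>\<theta>\<close> by \<open>\<mu>\<^sub>\<phi>\<close> costs at most \<open>max \<bar>A\<^sub>\<phi>\<^sup>\<Sigma>\<bar>\<close> times the
  \<open>\<ell>\<^sub>1\<close>-distance of the two laws. Within an epoch, \<open>F(x)\<close> is a sum over the SDM steps of integrals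
  against \<open>\<xi>\<^sub>\<theta>\<close>, and replacing \<open>\<xi>\<^sub>\<theta>\<close> by \<open>\<xi>\<^sub>\<phi>\<close> costs at most \<open>max \<bar>A\<^sub>\<phi>\<bar>\<close> times their
  \<open>\<ell>\<^sub>1\<close>-distance. What remains is an expectation under \<open>\<pi>\<^sub>\<phi>\<close> except for the last atomic action,
  which importance sampling turns into the likelihood ratio.
\<close>

section \<open>Expectations over discrete distributions\<close>

lemma integrable_measure_pmf_bounded:
  fixes f :: "'a \<Rightarrow> real"
  assumes "\<And>x. x \<in> set_pmf p \<Longrightarrow> \<bar>f x\<bar> \<le> B"
  shows "integrable (measure_pmf p) f"
  by (rule measure_pmf.integrable_const_bound[where B = B]) (use assms in \<open>auto simp: AE_measure_pmf_iff\<close>)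

lemma expectation_pmf_cong:
  assumes "\<And>x. x \<in> set_pmf p \<Longrightarrow> f x = g x"
  shows "measure_pmf.expectation p f = measure_pmf.expectation p g"
  by (rule integral_cong_AE) (use assms in \<open>auto simp: AE_measure_pmf_iff\<close>)

lemma abs_expectation_pmf_le:
  fixes f :: "'a \<Rightarrow> real"
  assumes "\<And>x. x \<in> set_pmf p \<Longrightarrow> \<bar>f x\<bar> \<le> B"
  shows "\<bar>measure_pmf.expectation p f\<bar> \<le> B"
proof -
  have "\<bar>measure_pmf.expectation p f\<bar> \<le> measure_pmf.expectation p (\<lambda>x. \<bar>f x\<bar>)"
    by (rule integral_abs_bound)
  also have "\<dots> \<le> measure_pmf.expectation p (\<lambda>_. B)"
    by (rule integral_mono_AE)
      (use assms in \<open>auto simp: AE_measure_pmf_iff intro!: integrable_measure_pmf_bounded[of _ _ B]\<close>)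
  finally show ?thesis by simp
qed

lemma expectation_pmf_mono:
  fixes f g :: "'a \<Rightarrow> real"
  assumes "integrable (measure_pmf p) f" "integrable (measure_pmf p) g"
    and "\<And>x. x \<in> set_pmf p \<Longrightarrow> f x \<le> g x"
  shows "measure_pmf.expectation p f \<le> measure_pmf.expectation p g"
  by (rule integral_mono_AE) (use assms in \<open>auto simp: AE_measure_pmf_iff\<close>)

text \<open>
  Likelihood ratios are unbounded over the infinitely many reachable states, so \<open>f\<close> is only assumed
  to be bounded in conditional mean.
\<close>

context
  fixes p :: "'a pmf" and q :: "'a \<Rightarrow> 'b pmf" and f :: "'b \<Rightarrow> real" and B :: real
  assumes integrable_each: "\<And>x. x \<in> set_pmf p \<Longrightarrow> integrable (measure_pmf (q x)) f"
    and bounded_each: "\<And>x. x \<in> set_pmf p \<Longrightarrow> measure_pmf.expectation (q x) (\<lambda>y. \<bar>f y\<bar>) \<le> B"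
begin

lemma integrable_bind_pmf: "integrable (measure_pmf (bind_pmf p q)) f"
proof (rule integrableI_bounded)
  have "(\<integral>\<^sup>+ y. ennreal (norm (f y)) \<partial>measure_pmf (bind_pmf p q))
      = (\<integral>\<^sup>+ x. \<integral>\<^sup>+ y. ennreal \<bar>f y\<bar> \<partial>measure_pmf (q x) \<partial>measure_pmf p)"
    by simp
  also have "\<dots> \<le> (\<integral>\<^sup>+ x. ennreal B \<partial>measure_pmf p)"
  proof (rule nn_integral_mono_AE, unfold AE_measure_pmf_iff, intro ballI)
    fix x assume x: "x \<in> set_pmf p"
    have "(\<integral>\<^sup>+ y. ennreal \<bar>f y\<bar> \<partial>measure_pmf (q x))
        = ennreal (measure_pmf.expectation (q x) (\<lambda>y. \<bar>f y\<bar>))"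
      by (rule nn_integral_eq_integral) (use integrable_each[OF x] in auto)
    then show "(\<integral>\<^sup>+ y. ennreal \<bar>f y\<bar> \<partial>measure_pmf (q x)) \<le> ennreal B"
      using bounded_each[OF x] by (simp add: ennreal_leI)
  qed
  also have "\<dots> < \<infinity>"
    by simp
  finally show "(\<integral>\<^sup>+ y. ennreal (norm (f y)) \<partial>measure_pmf (bind_pmf p q)) < \<infinity>" .
qed simp

lemma expectation_bind_pmf:
  "measure_pmf.expectation (bind_pmf p q) f
     = measure_pmf.expectation p (\<lambda>x. measure_pmf.expectation (q x) f)"
proof -
  let ?E = "\<lambda>g x. measure_pmf.expectation (q x) g"
  have abs_bd: "\<bar>?E g x\<bar> \<le> B"
    if "x \<in> set_pmf p" "\<And>y. \<bar>g y\<bar> \<le> \<bar>f y\<bar>" "integrable (measure_pmf (q x)) g" for g x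
  proof -
    have "\<bar>?E g x\<bar> \<le> ?E (\<lambda>y. \<bar>g y\<bar>) x"
      by (rule integral_abs_bound)
    also have "\<dots> \<le> ?E (\<lambda>y. \<bar>f y\<bar>) x"
      by (rule integral_mono) (use that integrable_each in auto)
    also have "\<dots> \<le> B"
      using bounded_each that by blast
    finally show ?thesis .
  qed
  have nonneg_case: "measure_pmf.expectation (bind_pmf p q) g = measure_pmf.expectation p (?E g)
      \<and> integrable (measure_pmf p) (?E g)"
    if nonneg: "\<And>y. 0 \<le> g y" and le: "\<And>y. \<bar>g y\<bar> \<le> \<bar>f y\<bar>"
      and int: "\<And>x. x \<in> set_pmf p \<Longrightarrow> integrable (measure_pmf (q x)) g" for g
  proof
    show int_E: "integrable (measure_pmf p) (?E g)"
      by (rule integrable_measure_pmf_bounded[of _ _ B]) (use abs_bd le int in auto)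
    have "measure_pmf.expectation (bind_pmf p q) g
        = enn2real (\<integral>\<^sup>+ x. \<integral>\<^sup>+ y. ennreal (g y) \<partial>measure_pmf (q x) \<partial>measure_pmf p)"
      using nonneg by (subst integral_eq_nn_integral) auto
    also have "(\<integral>\<^sup>+ x. \<integral>\<^sup>+ y. ennreal (g y) \<partial>measure_pmf (q x) \<partial>measure_pmf p)
        = (\<integral>\<^sup>+ x. ennreal (?E g x) \<partial>measure_pmf p)"
      by (rule nn_integral_cong_AE, unfold AE_measure_pmf_iff, intro ballI nn_integral_eq_integral)
        (use int nonneg in auto)
    also have "\<dots> = ennreal (measure_pmf.expectation p (?E g))"
      by (rule nn_integral_eq_integral) (use int_E nonneg in auto)
    finally show "measure_pmf.expectation (bind_pmf p q) g = measure_pmf.expectation p (?E g)"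
      using nonneg by simp
  qed
  define u v where "u y = max 0 (f y)" and "v y = max 0 (- f y)" for y
  have int_uv: "integrable (measure_pmf (q x)) u" "integrable (measure_pmf (q x)) v"
    if "x \<in> set_pmf p" for x
    using integrable_each[OF that] unfolding u_def v_def by auto
  have u: "measure_pmf.expectation (bind_pmf p q) u = measure_pmf.expectation p (?E u)
      \<and> integrable (measure_pmf p) (?E u)"
    by (rule nonneg_case) (use int_uv in \<open>auto simp: u_def\<close>)
  have v: "measure_pmf.expectation (bind_pmf p q) v = measure_pmf.expectation p (?E v)
      \<and> integrable (measure_pmf p) (?E v)"
    by (rule nonneg_case) (use int_uv in \<open>auto simp: v_def\<close>)
  have int_bind: "integrable (measure_pmf (bind_pmf p q)) u" "integrable (measure_pmf (bind_pmf p q)) v"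
    using integrable_bind_pmf unfolding u_def v_def by auto
  have "measure_pmf.expectation (bind_pmf p q) f
      = measure_pmf.expectation (bind_pmf p q) (\<lambda>y. u y - v y)"
    by (rule arg_cong[where f = "measure_pmf.expectation _"]) (auto simp: u_def v_def)
  also have "\<dots> = measure_pmf.expectation (bind_pmf p q) u - measure_pmf.expectation (bind_pmf p q) v"
    by (rule Bochner_Integration.integral_diff[OF int_bind])
  also have "\<dots> = measure_pmf.expectation p (\<lambda>x. ?E u x - ?E v x)"
    using u v by simp
  also have "\<dots> = measure_pmf.expectation p (?E f)"
  proof (rule expectation_pmf_cong)
    fix x assume x: "x \<in> set_pmf p"
    have "?E u x - ?E v x = ?E (\<lambda>y. u y - v y) x"
      by (rule Bochner_Integration.integral_diff[OF int_uv[OF x], symmetric])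
    also have "(\<lambda>y. u y - v y) = f"
      by (auto simp: u_def v_def)
    finally show "?E u x - ?E v x = ?E f x" .
  qed
  finally show ?thesis .
qed

end

lemma expectation_bind_pmf_bounded:
  fixes f :: "'b \<Rightarrow> real"
  assumes "\<And>y. y \<in> set_pmf (bind_pmf p q) \<Longrightarrow> \<bar>f y\<bar> \<le> B"
  shows "measure_pmf.expectation (bind_pmf p q) f
     = measure_pmf.expectation p (\<lambda>x. measure_pmf.expectation (q x) f)"
proof (rule expectation_bind_pmf[where B = B])
  fix x assume x: "x \<in> set_pmf p"
  then have bd: "\<bar>f y\<bar> \<le> B" if "y \<in> set_pmf (q x)" for y
    using assms that by auto
  show "integrable (measure_pmf (q x)) f"
    by (rule integrable_measure_pmf_bounded) (rule bd)
  have "\<bar>measure_pmf.expectation (q x) (\<lambda>y. \<bar>f y\<bar>)\<bar> \<le> B"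
    by (rule abs_expectation_pmf_le) (use bd in auto)
  then show "measure_pmf.expectation (q x) (\<lambda>y. \<bar>f y\<bar>) \<le> B"
    by simp
qed

lemma has_sum_expectation_pmf:
  fixes f :: "'a \<Rightarrow> real"
  assumes "integrable (measure_pmf p) f" "set_pmf p \<subseteq> S"
  shows "((\<lambda>x. pmf p x * f x) has_sum measure_pmf.expectation p f) S"
proof -
  have "integrable (count_space UNIV) (\<lambda>x. pmf p x * f x)"
    using assms(1) unfolding measure_pmf_eq_density by (subst (asm) integrable_density) auto
  then have abs: "Infinite_Set_Sum.abs_summable_on (\<lambda>x. pmf p x * f x) UNIV"
    by (simp add: Infinite_Set_Sum.abs_summable_on_def)
  then have summable: "(\<lambda>x. pmf p x * f x) summable_on UNIV"
    using abs_summable_equivalent abs_summable_summable by blast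
  have "measure_pmf.expectation p f = infsum (\<lambda>x. pmf p x * f x) UNIV"
    by (simp add: pmf_expectation_eq_infsetsum infsetsum_infsum[OF abs])
  with summable have "((\<lambda>x. pmf p x * f x) has_sum measure_pmf.expectation p f) UNIV"
    by simp
  then show ?thesis
    by (subst has_sum_cong_neutral[where T = UNIV and g = "\<lambda>x. pmf p x * f x"])
      (use assms(2) in \<open>auto simp: set_pmf_iff\<close>)
qed

lemma pmf_summable_on: "pmf p summable_on S"
proof -
  have "pmf p summable_on UNIV"
    using has_sum_expectation_pmf[of p "\<lambda>_. 1" UNIV] by (auto simp: summable_on_def)
  then show ?thesis
    by (rule summable_on_subset_banach) simp
qed

lemma abs_pmf_diff_summable_on: "(\<lambda>x. \<bar>pmf p x - pmf q x\<bar>) summable_on S"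
proof (rule summable_on_comparison_test)
  show "(\<lambda>x. pmf p x + pmf q x) summable_on S"
    by (intro summable_on_add pmf_summable_on)
next
  fix x
  show "\<bar>pmf p x - pmf q x\<bar> \<le> pmf p x + pmf q x"
    using pmf_nonneg[of p x] pmf_nonneg[of q x] by arith
qed simp

lemma infsum_abs_pmf_diff_le: "(\<Sum>\<^sub>\<infinity>x\<in>S. \<bar>pmf p x - pmf q x\<bar>) \<le> 2"
proof -
  have sum_le: "infsum (pmf r) S \<le> 1" for r :: "'a pmf"
  proof -
    have "infsum (pmf r) S \<le> infsum (pmf r) UNIV"
      by (rule infsum_mono_neutral) (auto intro: pmf_summable_on)
    also have "\<dots> = 1"
      using has_sum_expectation_pmf[of r "\<lambda>_. 1" UNIV] by (auto dest: infsumI)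
    finally show ?thesis .
  qed
  have "(\<Sum>\<^sub>\<infinity>x\<in>S. \<bar>pmf p x - pmf q x\<bar>) \<le> (\<Sum>\<^sub>\<infinity>x\<in>S. pmf p x + pmf q x)"
  proof (rule infsum_mono)
    fix x
    show "\<bar>pmf p x - pmf q x\<bar> \<le> pmf p x + pmf q x"
      using pmf_nonneg[of p x] pmf_nonneg[of q x] by arith
  qed (intro abs_pmf_diff_summable_on summable_on_add pmf_summable_on)+
  also have "\<dots> = infsum (pmf p) S + infsum (pmf q) S"
    by (rule infsum_add) (rule pmf_summable_on)+
  finally show ?thesis
    using sum_le[of p] sum_le[of q] by linarith
qed

lemma expectation_pmf_change:
  fixes f :: "'a \<Rightarrow> real"
  assumes S: "set_pmf p \<subseteq> S" "set_pmf q \<subseteq> S"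
    and bd: "\<And>x. x \<in> set_pmf p \<union> set_pmf q \<Longrightarrow> \<bar>f x\<bar> \<le> C"
  shows "measure_pmf.expectation q f - C * (\<Sum>\<^sub>\<infinity>x\<in>S. \<bar>pmf q x - pmf p x\<bar>)
     \<le> measure_pmf.expectation p f"
proof -
  have "integrable (measure_pmf p) f" "integrable (measure_pmf q) f"
    by (rule integrable_measure_pmf_bounded[of _ _ C]; use bd in blast)+
  then have sums: "((\<lambda>x. pmf p x * f x) has_sum measure_pmf.expectation p f) S"
    "((\<lambda>x. pmf q x * f x) has_sum measure_pmf.expectation q f) S"
    using S by (auto intro: has_sum_expectation_pmf)
  have diff: "((\<lambda>x. pmf q x * f x - pmf p x * f x) has_sum
      (measure_pmf.expectation q f - measure_pmf.expectation p f)) S"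
    using has_sum_add[OF sums(2) has_sum_cmult_right[OF sums(1), of "- 1"]] by simp
  have bound: "((\<lambda>x. C * \<bar>pmf q x - pmf p x\<bar>) has_sum C * (\<Sum>\<^sub>\<infinity>x\<in>S. \<bar>pmf q x - pmf p x\<bar>)) S"
    by (rule has_sum_cmult_right[OF has_sum_infsum[OF abs_pmf_diff_summable_on]])
  have "measure_pmf.expectation q f - measure_pmf.expectation p f
      \<le> C * (\<Sum>\<^sub>\<infinity>x\<in>S. \<bar>pmf q x - pmf p x\<bar>)"
  proof (rule has_sum_mono[OF diff bound])
    fix x
    show "pmf q x * f x - pmf p x * f x \<le> C * \<bar>pmf q x - pmf p x\<bar>"
    proof (cases "x \<in> set_pmf p \<union> set_pmf q")
      case True
      have "pmf q x * f x - pmf p x * f x = (pmf q x - pmf p x) * f x"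
        by (simp add: algebra_simps)
      also have "\<dots> \<le> \<bar>pmf q x - pmf p x\<bar> * \<bar>f x\<bar>"
        by (metis abs_ge_self abs_mult)
      also have "\<dots> \<le> \<bar>pmf q x - pmf p x\<bar> * C"
        by (rule mult_left_mono[OF bd[OF True]]) simp
      finally show ?thesis by (simp add: mult.commute)
    next
      case False
      then show ?thesis by (simp add: set_pmf_iff)
    qed
  qed
  then show ?thesis by simp
qed

section \<open>Marginal laws of the controlled process\<close>

text \<open>
  The index counts steps already made: \<open>sdm_law M p i\<close> is the law of the \<open>(i + 1)\<close>-st SDM state of
  an epoch, and \<open>epoch_law M p n x\<close> the law of the MDP state \<open>n\<close> epochs after \<open>x\<close>.
\<close>

primrec sdm_law ::
    "'r ride_model \<Rightarrow> 'r policy \<Rightarrow> nat \<Rightarrow> 'r sdm_state \<Rightarrow> 'r sdm_state pmf" where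
  "sdm_law M p 0 x = return_pmf x"
| "sdm_law M p (Suc i) x = bind_pmf (p x) (\<lambda>a. sdm_law M p i (atomic_step M x a))"

definition epoch_actions :: "('r::finite) ride_model \<Rightarrow> 'r policy \<Rightarrow> 'r mdp_state \<Rightarrow> 'r action list pmf" where
  "epoch_actions M p x = sample_actions M p (available M (start x)) (start x)"

definition epoch_step :: "('r::finite) ride_model \<Rightarrow> 'r mdp_state \<Rightarrow> 'r action list \<Rightarrow> 'r mdp_state pmf" where
  "epoch_step M x as = next_epoch M (foldl (atomic_step M) (start x) as)"

primrec epoch_law ::
    "('r::finite) ride_model \<Rightarrow> 'r policy \<Rightarrow> nat \<Rightarrow> 'r mdp_state \<Rightarrow> 'r mdp_state pmf" where
  "epoch_law M p 0 x = return_pmf x"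
| "epoch_law M p (Suc n) x =
     bind_pmf (bind_pmf (epoch_actions M p x) (epoch_step M x)) (epoch_law M p n)"

lemma sample_actions_Suc:
  "sample_actions M p (Suc k) x =
     bind_pmf (p x) (\<lambda>a. map_pmf ((#) a) (sample_actions M p k (atomic_step M x a)))"
  by (simp add: map_pmf_def)

lemma length_sample_actions: "as \<in> set_pmf (sample_actions M p k x) \<Longrightarrow> length as = k"
  by (induction k arbitrary: x as) auto

lemma map_sample_actions_state_action:
  assumes "i < k"
  shows "map_pmf (\<lambda>as. (foldl (atomic_step M) x (take i as), as ! i)) (sample_actions M p k x)
     = bind_pmf (sdm_law M p i x) (\<lambda>y. map_pmf (Pair y) (p y))"
  using assms
proof (induction i arbitrary: k x)
  case 0
  then obtain m where "k = Suc m"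
    using gr0_implies_Suc by blast
  then show ?case
    by (simp add: sample_actions_Suc map_bind_pmf map_pmf_comp bind_return_pmf del: sample_actions.simps)
      (simp add: map_pmf_def)
next
  case (Suc i)
  then obtain m where m: "k = Suc m" "i < m"
    using Suc_lessE by blast
  then show ?case
    by (simp add: sample_actions_Suc map_bind_pmf map_pmf_comp bind_assoc_pmf Suc.IH del: sample_actions.simps)
qed

lemma map_sample_actions_state:
  assumes "i < k"
  shows "map_pmf (\<lambda>as. foldl (atomic_step M) x (take i as)) (sample_actions M p k x) = sdm_law M p i x"
proof -
  have "map_pmf (\<lambda>as. foldl (atomic_step M) x (take i as)) (sample_actions M p k x)
      = map_pmf fst (map_pmf (\<lambda>as. (foldl (atomic_step M) x (take i as), as ! i)) (sample_actions M p k x))"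
    by (simp add: map_pmf_comp)
  also have "\<dots> = sdm_law M p i x"
    unfolding map_sample_actions_state_action[OF assms]
    by (simp add: map_bind_pmf map_pmf_comp bind_return_pmf')
  finally show ?thesis .
qed

lemma map_run_nth:
  assumes "t < n"
  shows "map_pmf (\<lambda>\<omega>. \<omega> ! t) (run M p n (start x))
     = bind_pmf (epoch_law M p t x) (\<lambda>y. map_pmf (Pair (start y)) (epoch_actions M p y))"
  using assms
proof (induction t arbitrary: n x)
  case 0
  then obtain m where "n = Suc m"
    using gr0_implies_Suc by blast
  then show ?case
    by (simp add: map_bind_pmf bind_return_pmf epoch_actions_def map_pmf_def bind_assoc_pmf)
next
  case (Suc t)
  then obtain m where m: "n = Suc m" "t < m"
    using Suc_lessE by blast
  have "map_pmf (\<lambda>\<omega>. \<omega> ! Suc t) (run M p (Suc m) (start x)) =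
      bind_pmf (epoch_actions M p x) (\<lambda>as. bind_pmf (epoch_step M x as)
        (\<lambda>y. map_pmf (\<lambda>\<omega>. \<omega> ! t) (run M p m (start y))))"
    by (simp add: map_pmf_def bind_assoc_pmf bind_return_pmf epoch_actions_def epoch_step_def)
  then show ?case
    by (simp add: m Suc.IH bind_assoc_pmf)
qed

lemma inj_start: "inj start"
  by (auto simp: inj_def start_def)

lemma occ_mdp_eq_pmf:
  assumes "t \<in> {1..horizon M}"
  shows "occ_mdp M p x1 t x = pmf (epoch_law M p (t - 1) x1) x"
proof -
  have "map_pmf (\<lambda>\<omega>. traj_start \<omega> t) (run M p (horizon M) (start x1))
      = map_pmf fst (map_pmf (\<lambda>\<omega>. \<omega> ! (t - 1)) (run M p (horizon M) (start x1)))"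
    by (simp add: map_pmf_comp traj_start_def)
  also have "\<dots> = map_pmf start (epoch_law M p (t - 1) x1)"
    using assms by (subst map_run_nth) (auto simp: map_bind_pmf map_pmf_comp map_pmf_def[of start])
  finally have law: "map_pmf (\<lambda>\<omega>. traj_start \<omega> t) (run M p (horizon M) (start x1))
      = map_pmf start (epoch_law M p (t - 1) x1)" .
  have "occ_mdp M p x1 t x = pmf (map_pmf (\<lambda>\<omega>. traj_start \<omega> t) (run M p (horizon M) (start x1))) (start x)"
    by (simp add: occ_mdp_def pmf_map vimage_def)
  then show ?thesis
    unfolding law by (simp add: pmf_map_inj' inj_start)
qed

lemma occ_sdm_eq_pmf:
  assumes "epoch x = t" "i \<in> {1..available M (start x)}"
  shows "occ_sdm M p t i x y = pmf (sdm_law M p (i - 1) (start x)) y"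
proof -
  have "i - 1 < available M (start x)"
    using assms(2) by auto
  then have "pmf (sdm_law M p (i - 1) (start x)) y =
      pmf (map_pmf (\<lambda>as. foldl (atomic_step M) (start x) (take (i - 1) as))
        (sample_actions M p (available M (start x)) (start x))) y"
    by (simp add: map_sample_actions_state)
  with assms(1) show ?thesis
    by (simp add: occ_sdm_def sdm_at_def pmf_map vimage_def)
qed

section \<open>Invariants of the dynamics\<close>

definition feasible_actions :: "'r ride_model \<Rightarrow> 'r sdm_state \<Rightarrow> 'r action list \<Rightarrow> bool" where
  "feasible_actions M x as \<longleftrightarrow>
     (\<forall>i<length as. feasible M (foldl (atomic_step M) x (take i as)) (as ! i))"

lemma feasible_actions_Nil [simp]: "feasible_actions M x []"
  by (simp add: feasible_actions_def)

lemma feasible_actions_Cons [simp]: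
  "feasible_actions M x (a # as) \<longleftrightarrow> feasible M x a \<and> feasible_actions M (atomic_step M x a) as"
  by (auto simp: feasible_actions_def nth_Cons take_Cons split: nat.splits)

lemma feasible_actions_take: "feasible_actions M x as \<Longrightarrow> feasible_actions M x (take i as)"
  by (auto simp: feasible_actions_def)

lemma sum_add_count:
  fixes K :: "'r::finite \<Rightarrow> nat"
  shows "(\<Sum>d\<in>UNIV. \<Sum>\<eta>\<le>K d. add_count d0 \<eta>0 c d \<eta>)
     = (\<Sum>d\<in>UNIV. \<Sum>\<eta>\<le>K d. c d \<eta>) + (if \<eta>0 \<le> K d0 then 1 else 0)"
proof -
  have "add_count d0 \<eta>0 c d \<eta> = c d \<eta> + (if d = d0 then if \<eta> = \<eta>0 then 1 else 0 else 0)" for d \<eta>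
    by (simp add: add_count_def)
  then have "(\<Sum>\<eta>\<le>K d. add_count d0 \<eta>0 c d \<eta>)
      = (\<Sum>\<eta>\<le>K d. c d \<eta>) + (if d = d0 then \<Sum>\<eta>\<le>K d0. if \<eta> = \<eta>0 then 1 else 0 else 0)" for d
    by (cases "d = d0") (simp_all only: sum.distrib if_True if_False sum.neutral_const refl)
  then have "(\<Sum>d\<in>UNIV. \<Sum>\<eta>\<le>K d. add_count d0 \<eta>0 c d \<eta>)
      = (\<Sum>d\<in>UNIV. (\<Sum>\<eta>\<le>K d. c d \<eta>) + (if d = d0 then \<Sum>\<eta>\<le>K d0. if \<eta> = \<eta>0 then 1 else 0 else 0))"
    by (simp only:)
  also have "\<dots> = (\<Sum>d\<in>UNIV. \<Sum>\<eta>\<le>K d. c d \<eta>) + (\<Sum>\<eta>\<le>K d0. if \<eta> = \<eta>0 then 1 else 0)"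
    by (simp only: sum.distrib sum.delta finite UNIV_I if_True)
  finally show ?thesis
    by simp
qed

lemma add_remove_count:
  assumes "c d0 \<eta>0 > 0"
  shows "add_count d0 \<eta>0 (remove_count d0 \<eta>0 c) = c"
  using assms by (auto simp: add_count_def remove_count_def)

lemma sum_remove_count:
  fixes K :: "'r::finite \<Rightarrow> nat"
  assumes "c d0 \<eta>0 > 0"
  shows "(\<Sum>d\<in>UNIV. \<Sum>\<eta>\<le>K d. remove_count d0 \<eta>0 c d \<eta>) + (if \<eta>0 \<le> K d0 then 1 else 0)
     = (\<Sum>d\<in>UNIV. \<Sum>\<eta>\<le>K d. c d \<eta>)"
  using sum_add_count[where K = K and c = "remove_count d0 \<eta>0 c" and ?d0.0 = d0 and ?\<eta>0.0 = \<eta>0]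
    add_remove_count[where c = c, OF assms] by simp

lemma closest_feasible:
  assumes "feasible M x (orig, d)"
  shows "cars x orig (closest x orig) > 0" "closest x orig \<le> patience M"
proof -
  obtain \<eta> where \<eta>: "\<eta> \<le> patience M" "cars x orig \<eta> > 0"
    using assms by (auto simp: feasible_def)
  show "cars x orig (closest x orig) > 0"
    unfolding closest_def by (rule LeastI[of "\<lambda>\<eta>. cars x orig \<eta> > 0", OF \<eta>(2)])
  have "closest x orig \<le> \<eta>"
    unfolding closest_def by (rule Least_le[of "\<lambda>\<eta>. cars x orig \<eta> > 0", OF \<eta>(2)])
  with \<eta> show "closest x orig \<le> patience M" by simp
qed

lemma travel_time_le_max:
  assumes "t \<in> {1..horizon M}"
  shows "travel_time M t orig d \<le> max_travel_time M d"
proof -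
  have "{travel_time M t orig d | t orig. t \<in> {1..horizon M}}
      = (\<lambda>(t, orig). travel_time M t orig d) ` ({1..horizon M} \<times> UNIV)"
    by auto
  then have "finite {travel_time M t orig d | t orig. t \<in> {1..horizon M}}"
    by simp
  then show ?thesis
    unfolding max_travel_time_def using assms by (intro Max_ge) auto
qed

lemma epoch_atomic_step [simp]: "epoch (atomic_step M x a) = epoch x"
  by (simp add: atomic_step_def Let_def split: prod.split)

lemma feasible_iff_available:
  "(\<exists>a. feasible M x a) \<longleftrightarrow> epoch x \<in> {1..horizon M} \<and> available M x > 0"
proof -
  have "available M x = 0 \<longleftrightarrow> (\<forall>orig. \<forall>\<eta>\<le>patience M. cars x orig \<eta> = 0)"
    by (auto simp: available_def)
  then show ?thesis
    unfolding feasible_def by auto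
qed

lemma atomic_step_feasible:
  assumes valid: "valid_model M" and x: "x \<in> sdm_states M" and feas: "feasible M x a"
  shows "atomic_step M x a \<in> sdm_states M"
    and "Suc (available M (atomic_step M x a)) = available M x"
proof -
  obtain orig d where a: "a = (orig, d)" by fastforce
  define \<eta> where "\<eta> = closest x orig"
  define \<tau> where "\<tau> = \<eta> + travel_time M (epoch x) orig d"
  have t: "epoch x \<in> {1..horizon M}"
    using feas by (simp add: feasible_def)
  have \<eta>: "cars x orig \<eta> > 0" "\<eta> \<le> patience M"
    using closest_feasible[of M x orig d] feas unfolding \<eta>_def a by simp_all
  have \<tau>: "patience M < \<tau>" "\<tau> \<le> max_travel_time M d + patience M"
    using valid[unfolded valid_model_def] t \<eta>(2) travel_time_le_max[OF t, of orig d]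
    unfolding \<tau>_def by (auto simp: trans_less_add2)
  let ?K = "\<lambda>d. max_travel_time M d + patience M"
  let ?L = "\<lambda>_::'a. patience M"
  let ?moved = "add_count d \<tau> (remove_count orig \<eta> (cars x))"
  let ?removed = "remove_count orig \<eta> (cars x)"
  let ?idle = "add_count orig \<eta> (idle x)"
  have step: "cars (atomic_step M x a) = ?moved \<and> idle (atomic_step M x a) = idle x
      \<or> cars (atomic_step M x a) = ?removed \<and> idle (atomic_step M x a) = ?idle"
    by (auto simp: a atomic_step_def Let_def \<eta>_def \<tau>_def)
  note sums = sum_add_count[of d \<tau> "?removed" ?K] sum_add_count[of d \<tau> "?removed" ?L]
    sum_remove_count[of "cars x" orig \<eta> ?K, OF \<eta>(1)] sum_remove_count[of "cars x" orig \<eta> ?L, OF \<eta>(1)]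
    sum_add_count[of orig \<eta> "idle x" ?L]
  have K\<eta>: "\<eta> \<le> ?K orig" and L\<tau>: "\<not> \<tau> \<le> patience M"
    using \<eta> \<tau> by simp_all
  note sums' = sums[unfolded if_P[OF K\<eta>] if_P[OF \<eta>(2)] if_P[OF \<tau>(2)] if_not_P[OF L\<tau>]]
  have total: "(\<Sum>d\<in>UNIV. \<Sum>\<eta>\<le>?K d. cars x d \<eta>) + (\<Sum>d\<in>UNIV. \<Sum>\<eta>\<le>patience M. idle x d \<eta>) = num_cars M"
    using x by (simp add: sdm_states_def)
  have out: "?moved d' \<eta>' = 0 \<and> ?removed d' \<eta>' = 0" if "\<eta>' > ?K d'" for d' \<eta>'
    using x that \<eta> \<tau> by (auto simp: sdm_states_def add_count_def remove_count_def)
  have out_idle: "idle x d' \<eta>' = 0 \<and> ?idle d' \<eta>' = 0" if "\<eta>' > patience M" for d' \<eta>'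
    using x that \<eta> by (auto simp: sdm_states_def add_count_def)
  from step show "atomic_step M x a \<in> sdm_states M"
  proof (elim disjE conjE)
    assume c: "cars (atomic_step M x a) = ?moved" "idle (atomic_step M x a) = idle x"
    show ?thesis
      unfolding sdm_states_def mem_Collect_eq c epoch_atomic_step
      using total sums' t out out_idle by (intro conjI allI impI) simp_all
  next
    assume c: "cars (atomic_step M x a) = ?removed" "idle (atomic_step M x a) = ?idle"
    show ?thesis
      unfolding sdm_states_def mem_Collect_eq c epoch_atomic_step
      using total sums' t out out_idle by (intro conjI allI impI) simp_all
  qed
  from step show "Suc (available M (atomic_step M x a)) = available M x"
  proof (elim disjE conjE)
    assume c: "cars (atomic_step M x a) = ?moved"
    show ?thesis unfolding available_def c using sums' by simp
  next
    assume c: "cars (atomic_step M x a) = ?removed"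
    show ?thesis unfolding available_def c using sums' by simp
  qed
qed

lemma foldl_feasible_actions:
  assumes "valid_model M" "x \<in> sdm_states M" "feasible_actions M x as"
  shows "foldl (atomic_step M) x as \<in> sdm_states M"
    and "available M (foldl (atomic_step M) x as) + length as = available M x"
    and "epoch (foldl (atomic_step M) x as) = epoch x"
proof -
  have "foldl (atomic_step M) x as \<in> sdm_states M
      \<and> available M (foldl (atomic_step M) x as) + length as = available M x
      \<and> epoch (foldl (atomic_step M) x as) = epoch x"
    using assms(2,3)
  proof (induction as arbitrary: x)
    case (Cons a as)
    then show ?case
      using atomic_step_feasible[OF assms(1) Cons.prems(1), of a] Cons.IH[of "atomic_step M x a"] by auto
  qed simp
  then show "foldl (atomic_step M) x as \<in> sdm_states M"
    "available M (foldl (atomic_step M) x as) + length as = available M x"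
    "epoch (foldl (atomic_step M) x as) = epoch x" by auto
qed

lemma start_simps [simp]:
  "epoch (start x) = epoch x" "cars (start x) = cars x" "passengers (start x) = passengers x"
  "idle (start x) = (\<lambda>_ _. 0)"
  by (simp_all add: start_def)

lemma start_in_sdm_states: "x \<in> mdp_states M \<Longrightarrow> start x \<in> sdm_states M"
  by (simp add: mdp_states_def sdm_states_def)

lemma available_le_num_cars:
  assumes "x \<in> sdm_states M"
  shows "available M x \<le> num_cars M"
proof -
  have "available M x \<le> (\<Sum>d\<in>UNIV. \<Sum>\<eta>\<le>max_travel_time M d + patience M. cars x d \<eta>)"
    unfolding available_def by (intro sum_mono sum_mono2) auto
  with assms show ?thesis by (simp add: sdm_states_def)
qed

lemma sum_shift_to_zero:
  fixes c :: "nat \<Rightarrow> nat"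
  assumes "c (Suc K) = 0"
  shows "(\<Sum>\<eta>\<le>K. if \<eta> = 0 then c 0 + c 1 else c (\<eta> + 1)) = (\<Sum>\<eta>\<le>K. c \<eta>)"
proof -
  have "(\<Sum>\<eta>\<le>K. if \<eta> = 0 then c 0 + c 1 else c (\<eta> + 1)) = c 0 + (\<Sum>\<eta>\<le>K. c (Suc \<eta>))"
    by (cases K) (simp_all add: sum.atMost_Suc_shift del: sum.atMost_Suc)
  also have "\<dots> = (\<Sum>\<eta>\<le>Suc K. c \<eta>)"
    by (simp only: sum.atMost_Suc_shift)
  finally show ?thesis using assms by simp
qed

lemma next_epoch_states:
  assumes x: "x \<in> sdm_states M" "epoch x \<le> horizon M" and y: "y \<in> set_pmf (next_epoch M x)"
  shows "y \<in> mdp_states M" "epoch y = Suc (epoch x)"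
proof -
  have y': "cars y = next_cars x" "epoch y = Suc (epoch x)"
    using y by (auto simp: next_epoch_def)
  let ?K = "\<lambda>d. max_travel_time M d + patience M"
  have zero: "cars x d \<eta> + idle x d \<eta> = 0" if "\<eta> > ?K d" for d \<eta>
    using x that by (auto simp: sdm_states_def)
  have idle: "(\<Sum>\<eta>\<le>?K d. idle x d \<eta>) = (\<Sum>\<eta>\<le>patience M. idle x d \<eta>)" for d
    by (rule sum.mono_neutral_right) (use x in \<open>auto simp: sdm_states_def\<close>)
  have "(\<Sum>d\<in>UNIV. \<Sum>\<eta>\<le>?K d. next_cars x d \<eta>) = (\<Sum>d\<in>UNIV. \<Sum>\<eta>\<le>?K d. cars x d \<eta> + idle x d \<eta>)"
    unfolding next_cars_def Let_def
    by (intro sum.cong refl sum_shift_to_zero[where c = "\<lambda>\<eta>. cars x _ \<eta> + idle x _ \<eta>"] zero) simp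
  also have "\<dots> = num_cars M"
    using x by (simp add: sum.distrib idle sdm_states_def)
  finally show "y \<in> mdp_states M"
    using x zero by (auto simp: mdp_states_def y' sdm_states_def next_cars_def Let_def)
  show "epoch y = Suc (epoch x)" by (rule y'(2))
qed

section \<open>Value and advantage functions\<close>

definition path_sum ::
    "'r ride_model \<Rightarrow> ('r sdm_state \<Rightarrow> 'r action \<Rightarrow> real) \<Rightarrow> 'r sdm_state \<Rightarrow> 'r action list \<Rightarrow> real" where
  "path_sum M g x as = (\<Sum>i=1..length as. g (sdm_at M x as i) (as ! (i - 1)))"

lemma path_sum_eq:
  "path_sum M g x as = (\<Sum>i<length as. g (foldl (atomic_step M) x (take i as)) (as ! i))"
  by (simp add: path_sum_def sdm_at_def sum.atLeast1_atMost_eq)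

lemma path_sum_Nil [simp]: "path_sum M g x [] = 0"
  by (simp add: path_sum_def)

lemma path_sum_Cons [simp]:
  "path_sum M g x (a # as) = g x a + path_sum M g (atomic_step M x a) as"
  by (simp add: path_sum_eq sum.lessThan_Suc_shift del: sum.lessThan_Suc)

lemma abs_path_sum_le:
  assumes "valid_model M" "x \<in> sdm_states M" "feasible_actions M x as"
    and "\<And>y a. (y, a) \<in> sdm_pairs M \<Longrightarrow> \<bar>g y a\<bar> \<le> B"
  shows "\<bar>path_sum M g x as\<bar> \<le> real (length as) * B"
  using assms(2,3)
proof (induction as arbitrary: x)
  case (Cons a as)
  have "\<bar>g x a\<bar> \<le> B"
    using Cons.prems by (intro assms(4)) (simp add: sdm_pairs_def)
  moreover have "\<bar>path_sum M g (atomic_step M x a) as\<bar> \<le> real (length as) * B"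
    using Cons.prems atomic_step_feasible[OF assms(1)] by (intro Cons.IH) auto
  ultimately show ?case
    by (simp add: algebra_simps)
qed simp

lemma total_reward_Cons:
  "total_reward M ((x, as) # \<omega>) = path_sum M (reward M) x as + total_reward M \<omega>"
  by (simp add: total_reward_def path_sum_def)

lemma reward_bounded:
  fixes M :: "('r::finite) ride_model"
  obtains B where "B \<ge> 0" "\<And>x a. feasible M x a \<Longrightarrow> \<bar>reward M x a\<bar> \<le> B"
proof -
  let ?R = "(\<lambda>(t, orig, d, \<eta>). match_reward M t orig d \<eta>) ` ({1..horizon M} \<times> UNIV \<times> UNIV \<times> {..patience M})
    \<union> (\<lambda>(t, orig, d). - empty_cost M t orig d) ` ({1..horizon M} \<times> UNIV \<times> UNIV) \<union> {0}"
  have "bounded ?R"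
    by (intro finite_imp_bounded) simp
  then obtain B where B: "\<And>r. r \<in> ?R \<Longrightarrow> \<bar>r\<bar> \<le> B"
    unfolding bounded_iff by (metis real_norm_def)
  show thesis
  proof
    show "B \<ge> 0" using B[of 0] by simp
    fix x a assume feas: "feasible M x a"
    obtain orig d where a: "a = (orig, d)" by fastforce
    have "epoch x \<in> {1..horizon M}" "closest x orig \<le> patience M"
      using feas closest_feasible(2)[of M x orig d] by (auto simp: a feasible_def)
    then have "match_reward M (epoch x) orig d (closest x orig) \<in> ?R" "- empty_cost M (epoch x) orig d \<in> ?R"
      by (intro UnI1 image_eqI[where x = "(epoch x, orig, d, closest x orig)"]; auto)
        (intro UnI1 UnI2 image_eqI[where x = "(epoch x, orig, d)"]; use \<open>epoch x \<in> _\<close> in auto)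
    then have "reward M x a \<in> ?R"
      unfolding a reward_def by auto
    then show "\<bar>reward M x a\<bar> \<le> B" by (rule B)
  qed
qed

lemma mdp_pairsD:
  assumes "(x, as) \<in> mdp_pairs M"
  shows "x \<in> mdp_states M" "epoch x \<le> horizon M" "length as = available M (start x)"
    "feasible_actions M (start x) as"
proof -
  show "x \<in> mdp_states M" "epoch x \<le> horizon M" and len: "length as = available M (start x)"
    using assms by (auto simp: mdp_pairs_def)
  show "feasible_actions M (start x) as"
    unfolding feasible_actions_def
  proof (intro allI impI)
    fix i assume "i < length as"
    then have "Suc i \<in> {1..length as}" by simp
    then show "feasible M (foldl (atomic_step M) (start x) (take i as)) (as ! i)"
      using assms unfolding mdp_pairs_def sdm_at_def by force
  qed
qed

lemma epoch_step_states:
  assumes "valid_model M" "(x, as) \<in> mdp_pairs M" "y \<in> set_pmf (epoch_step M x as)"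
  shows "y \<in> mdp_states M" "epoch y = Suc (epoch x)"
proof -
  note x = mdp_pairsD[OF assms(2)]
  show "y \<in> mdp_states M" "epoch y = Suc (epoch x)"
    using next_epoch_states[of "foldl (atomic_step M) (start x) as" M y]
      foldl_feasible_actions[OF assms(1) start_in_sdm_states[OF x(1)] x(4)] x(2) assms(3)
    by (auto simp: epoch_step_def)
qed

locale ride_policy =
  fixes M :: "('r::finite) ride_model" and p :: "'r policy"
  assumes valid: "valid_model M" and admissible: "admissible_policy M p"
begin

lemma policy_feasible:
  assumes "x \<in> sdm_states M" "epoch x \<le> horizon M" "available M x > 0" "a \<in> set_pmf (p x)"
  shows "feasible M x a"
proof -
  have "\<exists>a. feasible M x a"
    unfolding feasible_iff_available using assms by (simp add: sdm_states_def)
  then show ?thesis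
    using assms admissible unfolding admissible_policy_def set_pmf_iff by blast
qed

lemma sample_actions_feasible:
  assumes "x \<in> sdm_states M" "epoch x \<le> horizon M" "k \<le> available M x"
    and "as \<in> set_pmf (sample_actions M p k x)"
  shows "feasible_actions M x as"
  using assms
proof (induction k arbitrary: x as)
  case (Suc k)
  then obtain a as' where as: "as = a # as'" "a \<in> set_pmf (p x)"
    "as' \<in> set_pmf (sample_actions M p k (atomic_step M x a))"
    by auto
  have a: "feasible M x a"
    using Suc.prems as by (intro policy_feasible) auto
  show ?case
    using atomic_step_feasible[OF valid Suc.prems(1) a] Suc.prems a as Suc.IH[OF _ _ _ as(3)] by auto
qed simp

lemma finite_sample_actions: "finite (set_pmf (sample_actions M p k x))"
  by (induction k arbitrary: x) (auto intro: finite_subset[OF subset_UNIV])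

lemma sdm_law_states:
  assumes "x \<in> sdm_states M" "epoch x \<le> horizon M" "i < available M x" "y \<in> set_pmf (sdm_law M p i x)"
  shows "y \<in> sdm_states M" "epoch y = epoch x" "available M y + i = available M x"
proof -
  obtain as where as: "as \<in> set_pmf (sample_actions M p (available M x) x)"
    and y: "y = foldl (atomic_step M) x (take i as)"
    using assms(3,4) by (auto simp flip: map_sample_actions_state)
  have "feasible_actions M x (take i as)" "length (take i as) = i"
    using sample_actions_feasible[OF assms(1,2) order_refl as] length_sample_actions[OF as] assms(3)
    by (simp_all add: feasible_actions_take)
  then show "y \<in> sdm_states M" "epoch y = epoch x" "available M y + i = available M x"
    using foldl_feasible_actions[OF valid assms(1), of "take i as"] y by auto
qed

lemma sdm_law_pairs:
  assumes "x \<in> sdm_states M" "epoch x \<le> horizon M" "i < available M x"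
    and "y \<in> set_pmf (sdm_law M p i x)" "a \<in> set_pmf (p y)"
  shows "(y, a) \<in> sdm_pairs M"
  using sdm_law_states[OF assms(1-4)] assms by (simp add: sdm_pairs_def policy_feasible)

lemma epoch_actions_pairs:
  assumes "x \<in> mdp_states M" "epoch x \<le> horizon M" "as \<in> set_pmf (epoch_actions M p x)"
  shows "(x, as) \<in> mdp_pairs M"
proof -
  have "feasible_actions M (start x) as" "length as = available M (start x)"
    using sample_actions_feasible[of "start x"] length_sample_actions assms
    by (auto simp: epoch_actions_def start_in_sdm_states)
  then show ?thesis
    using assms by (auto simp: mdp_pairs_def feasible_actions_def sdm_at_def)
qed

lemma epoch_law_states:
  assumes "x \<in> mdp_states M" "epoch x + t \<le> horizon M + 1" "y \<in> set_pmf (epoch_law M p t x)"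
  shows "y \<in> mdp_states M \<and> epoch y = epoch x + t"
  using assms
proof (induction t arbitrary: x)
  case (Suc t)
  then obtain as z where z: "as \<in> set_pmf (epoch_actions M p x)" "z \<in> set_pmf (epoch_step M x as)"
    "y \<in> set_pmf (epoch_law M p t z)"
    by auto
  have "z \<in> mdp_states M" "epoch z = Suc (epoch x)"
    using epoch_step_states[OF valid epoch_actions_pairs z(2)] Suc.prems z(1) by auto
  then show ?case
    using Suc.IH[OF _ _ z(3)] Suc.prems by simp
qed simp

lemma total_reward_bounded:
  assumes B: "B \<ge> 0" "\<And>x a. feasible M x a \<Longrightarrow> \<bar>reward M x a\<bar> \<le> B"
    and "x \<in> sdm_states M" "epoch x + n \<le> horizon M + 1" "\<omega> \<in> set_pmf (run M p n x)"
  shows "\<bar>total_reward M \<omega>\<bar> \<le> real n * (real (num_cars M) * B)"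
  using assms(3-5)
proof (induction n arbitrary: x \<omega>)
  case (Suc n)
  then obtain as y \<omega>' where as: "as \<in> set_pmf (sample_actions M p (available M x) x)"
    and y: "y \<in> set_pmf (next_epoch M (foldl (atomic_step M) x as))"
    and \<omega>': "\<omega>' \<in> set_pmf (run M p n (start y))" "\<omega> = (x, as) # \<omega>'"
    by auto
  have len: "length as \<le> num_cars M"
    using length_sample_actions[OF as] available_le_num_cars[OF Suc.prems(1)] by simp
  have feas: "feasible_actions M x as"
    using sample_actions_feasible[OF Suc.prems(1) _ order_refl as] Suc.prems(2) by simp
  have "y \<in> mdp_states M" "epoch y = Suc (epoch x)"
    using next_epoch_states[OF _ _ y] foldl_feasible_actions[OF valid Suc.prems(1) feas] Suc.prems(2)
    by auto
  then have "\<bar>total_reward M \<omega>'\<bar> \<le> real n * (real (num_cars M) * B)"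
    using Suc.prems(2) by (intro Suc.IH[OF _ _ \<omega>'(1)]) (auto simp: start_in_sdm_states)
  moreover have "\<bar>path_sum M (reward M) x as\<bar> \<le> real (length as) * B"
    by (rule abs_path_sum_le[OF valid Suc.prems(1) feas]) (simp add: sdm_pairs_def B(2))
  moreover have "real (length as) * B \<le> real (num_cars M) * B"
    using len B(1) by (intro mult_right_mono) auto
  ultimately show ?case
    by (simp add: \<omega>'(2) total_reward_Cons algebra_simps)
qed (simp add: total_reward_def)

lemma value_fun_bounded:
  obtains C where "C \<ge> 0" "\<And>x. x \<in> sdm_states M \<Longrightarrow> \<bar>value_fun M p x\<bar> \<le> C"
proof -
  obtain B where B: "B \<ge> 0" "\<And>x a. feasible M x a \<Longrightarrow> \<bar>reward M x a\<bar> \<le> B"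
    by (rule reward_bounded[of M]) blast
  show thesis
  proof
    show "real (horizon M) * (real (num_cars M) * B) \<ge> 0"
      using B(1) by simp
    fix x assume x: "x \<in> sdm_states M"
    then have n: "epoch x + (horizon M + 1 - epoch x) \<le> horizon M + 1" "horizon M + 1 - epoch x \<le> horizon M"
      by (auto simp: sdm_states_def)
    have "\<bar>value_fun M p x\<bar> \<le> real (horizon M + 1 - epoch x) * (real (num_cars M) * B)"
      unfolding value_fun_def
      by (rule abs_expectation_pmf_le) (rule total_reward_bounded[OF B x n(1)])
    also have "\<dots> \<le> real (horizon M) * (real (num_cars M) * B)"
      using n(2) B(1) by (intro mult_right_mono) auto
    finally show "\<bar>value_fun M p x\<bar> \<le> real (horizon M) * (real (num_cars M) * B)" .
  qed
qed

definition continuation :: "'r sdm_state \<Rightarrow> real" where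
  "continuation x = measure_pmf.expectation (next_epoch M x) (\<lambda>y. value_fun M p (start y))"

lemma continuation_bounded:
  assumes "\<And>x. x \<in> sdm_states M \<Longrightarrow> \<bar>value_fun M p x\<bar> \<le> C"
    and "x \<in> sdm_states M" "epoch x \<le> horizon M"
  shows "\<bar>continuation x\<bar> \<le> C"
  unfolding continuation_def
  by (intro abs_expectation_pmf_le assms(1) start_in_sdm_states next_epoch_states(1)[OF assms(2,3)])

lemma value_fun_rec:
  assumes x: "x \<in> sdm_states M" "epoch x \<le> horizon M"
  shows "value_fun M p x = measure_pmf.expectation (sample_actions M p (available M x) x)
    (\<lambda>as. path_sum M (reward M) x as + continuation (foldl (atomic_step M) x as))"
proof -
  obtain B where B: "B \<ge> 0" "\<And>x a. feasible M x a \<Longrightarrow> \<bar>reward M x a\<bar> \<le> B"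
    by (rule reward_bounded[of M]) blast
  obtain C where C: "\<And>x. x \<in> sdm_states M \<Longrightarrow> \<bar>value_fun M p x\<bar> \<le> C"
    by (rule value_fun_bounded) blast
  define n where "n = horizon M - epoch x"
  have n: "horizon M + 1 - epoch x = Suc n" "epoch x + Suc n \<le> horizon M + 1"
    using x(2) by (auto simp: n_def)
  let ?tail = "\<lambda>as y. map_pmf ((#) (x, as)) (run M p n (start y))"
  let ?rest = "\<lambda>as. bind_pmf (next_epoch M (foldl (atomic_step M) x as)) (?tail as)"
  have run: "run M p (Suc n) x = bind_pmf (sample_actions M p (available M x) x) ?rest"
    by (simp add: map_pmf_def)
  have bd: "\<bar>total_reward M \<omega>\<bar> \<le> real (Suc n) * (real (num_cars M) * B)"
    if "\<omega> \<in> set_pmf (run M p (Suc n) x)" for \<omega>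
    using that x n by (intro total_reward_bounded[OF B]) auto
  have "value_fun M p x = measure_pmf.expectation (sample_actions M p (available M x) x)
      (\<lambda>as. measure_pmf.expectation (?rest as) (total_reward M))"
    unfolding value_fun_def n(1) run
    by (rule expectation_bind_pmf_bounded) (rule bd[unfolded run])
  also have "\<dots> = measure_pmf.expectation (sample_actions M p (available M x) x)
      (\<lambda>as. path_sum M (reward M) x as + continuation (foldl (atomic_step M) x as))"
  proof (rule expectation_pmf_cong)
    fix as assume as: "as \<in> set_pmf (sample_actions M p (available M x) x)"
    have "feasible_actions M x as"
      by (rule sample_actions_feasible[OF x order_refl as])
    then have z: "foldl (atomic_step M) x as \<in> sdm_states M"
      "epoch (foldl (atomic_step M) x as) = epoch x"
      using foldl_feasible_actions[OF valid x(1)] by auto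
    have y: "start y \<in> sdm_states M" "epoch y = Suc (epoch x)"
      if "y \<in> set_pmf (next_epoch M (foldl (atomic_step M) x as))" for y
      using next_epoch_states[OF _ _ that] z x(2) by (auto simp: start_in_sdm_states)
    have "measure_pmf.expectation (?rest as) (total_reward M)
        = measure_pmf.expectation (next_epoch M (foldl (atomic_step M) x as))
            (\<lambda>y. measure_pmf.expectation (?tail as y) (total_reward M))"
      by (rule expectation_bind_pmf_bounded) (rule bd, use as run in auto)
    also have "\<dots> = measure_pmf.expectation (next_epoch M (foldl (atomic_step M) x as))
            (\<lambda>y. path_sum M (reward M) x as + value_fun M p (start y))"
    proof (rule expectation_pmf_cong)
      fix y assume y': "y \<in> set_pmf (next_epoch M (foldl (atomic_step M) x as))"
      have "integrable (measure_pmf (run M p n (start y))) (total_reward M)"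
        by (rule integrable_measure_pmf_bounded, rule total_reward_bounded[OF B])
          (use y[OF y'] x n in auto)
      moreover have "horizon M + 1 - epoch (start y) = n"
        using y(2)[OF y'] by (simp add: n_def)
      ultimately show "measure_pmf.expectation (?tail as y) (total_reward M)
          = path_sum M (reward M) x as + value_fun M p (start y)"
        by (simp add: total_reward_Cons value_fun_def)
    qed
    also have "\<dots> = path_sum M (reward M) x as + continuation (foldl (atomic_step M) x as)"
      unfolding continuation_def
      by (subst Bochner_Integration.integral_add)
        (auto intro!: integrable_measure_pmf_bounded[of _ _ C] C y)
    finally show "measure_pmf.expectation (?rest as) (total_reward M)
        = path_sum M (reward M) x as + continuation (foldl (atomic_step M) x as)" .
  qed
  finally show ?thesis .
qed

lemma value_fun_unavailable:
  assumes "x \<in> sdm_states M" "epoch x \<le> horizon M" "available M x = 0"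
  shows "value_fun M p x = continuation x"
  using value_fun_rec[OF assms(1,2)] assms(3) by simp

lemma infsum_trans_prob:
  assumes "(x, a) \<in> sdm_pairs M"
  shows "(\<Sum>\<^sub>\<infinity>y\<in>sdm_states M. trans_prob M x a y * value_fun M p y) = continuation (atomic_step M x a)"
proof -
  obtain C where C: "\<And>x. x \<in> sdm_states M \<Longrightarrow> \<bar>value_fun M p x\<bar> \<le> C"
    by (rule value_fun_bounded) blast
  have "atomic_step M x a \<in> sdm_states M" "epoch x \<le> horizon M"
    using assms atomic_step_feasible[OF valid] by (auto simp: sdm_pairs_def feasible_def)
  then have sub: "set_pmf (map_pmf start (next_epoch M (atomic_step M x a))) \<subseteq> sdm_states M"
    using next_epoch_states(1)[of "atomic_step M x a" M] by (auto intro!: start_in_sdm_states)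
  then have "integrable (measure_pmf (map_pmf start (next_epoch M (atomic_step M x a)))) (value_fun M p)"
    by (intro integrable_measure_pmf_bounded[of _ _ C] C) blast
  then show ?thesis
    unfolding trans_prob_def continuation_def
    using infsumI[OF has_sum_expectation_pmf[OF _ sub]] by simp
qed

lemma advantage_bounded:
  obtains C where "C \<ge> 0" "\<And>x a. (x, a) \<in> sdm_pairs M \<Longrightarrow> \<bar>advantage M p x a\<bar> \<le> C"
proof -
  obtain B where B: "B \<ge> 0" "\<And>x a. feasible M x a \<Longrightarrow> \<bar>reward M x a\<bar> \<le> B"
    by (rule reward_bounded[of M]) blast
  obtain C where C: "C \<ge> 0" "\<And>x. x \<in> sdm_states M \<Longrightarrow> \<bar>value_fun M p x\<bar> \<le> C"
    by (rule value_fun_bounded) blast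
  show thesis
  proof
    show "B + 2 * C \<ge> 0" using B C by simp
    fix x a assume xa: "(x, a) \<in> sdm_pairs M"
    then have x: "x \<in> sdm_states M" "feasible M x a" "epoch x \<le> horizon M"
      and z: "atomic_step M x a \<in> sdm_states M"
      using atomic_step_feasible[OF valid] by (auto simp: sdm_pairs_def feasible_def)
    have "\<bar>reward M x a\<bar> \<le> B" "\<bar>value_fun M p x\<bar> \<le> C" "\<bar>value_fun M p (atomic_step M x a)\<bar> \<le> C"
      "\<bar>continuation (atomic_step M x a)\<bar> \<le> C"
      using x z B(2) C(2) by (auto intro!: continuation_bounded)
    then show "\<bar>advantage M p x a\<bar> \<le> B + 2 * C"
      unfolding advantage_def infsum_trans_prob[OF xa] by (auto simp: abs_le_iff)
  qed
qed

lemma path_sum_advantage: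
  assumes "x \<in> sdm_states M" "epoch x \<le> horizon M" "feasible_actions M x as"
    and "length as = available M x"
  shows "path_sum M (advantage M p) x as
    = path_sum M (reward M) x as + continuation (foldl (atomic_step M) x as) - value_fun M p x"
  using assms
proof (induction as arbitrary: x)
  case Nil
  then show ?case
    by (simp add: value_fun_unavailable)
next
  case (Cons a as)
  let ?y = "atomic_step M x a"
  have pair: "(x, a) \<in> sdm_pairs M"
    using Cons.prems by (simp add: sdm_pairs_def)
  have y: "?y \<in> sdm_states M" "length as = available M ?y"
    using atomic_step_feasible[OF valid Cons.prems(1), of a] Cons.prems by auto
  have "advantage M p x a = reward M x a + value_fun M p ?y - value_fun M p x"
  proof (cases "available M ?y = 0")
    case True
    then have "available M x = 1"
      using y Cons.prems by simp
    then show ?thesis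
      using Cons.prems y True
      by (simp add: advantage_def infsum_trans_prob[OF pair] value_fun_unavailable[of ?y])
  next
    case False
    then have "available M x > 1"
      using y Cons.prems by simp
    then show ?thesis
      by (simp add: advantage_def)
  qed
  then show ?case
    using Cons.IH[of ?y] y Cons.prems by simp
qed

end

lemma mdp_advantage_eq_path_sum:
  "length as = available M (start x) \<Longrightarrow> mdp_advantage M p x as = path_sum M (advantage M p) (start x) as"
  by (simp add: mdp_advantage_def path_sum_def)

lemma sum_available_le:
  fixes f :: "nat \<Rightarrow> real"
  assumes "x \<in> mdp_states M" "C \<ge> 0" "\<And>i. i < available M (start x) \<Longrightarrow> \<bar>f i\<bar> \<le> C"
  shows "\<bar>\<Sum>i<available M (start x). f i\<bar> \<le> real (num_cars M) * C"
proof -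
  have "\<bar>\<Sum>i<available M (start x). f i\<bar> \<le> (\<Sum>i<available M (start x). C)"
    by (rule order_trans[OF sum_abs sum_mono]) (use assms(3) in auto)
  also have "\<dots> \<le> real (num_cars M) * C"
    using available_le_num_cars[OF start_in_sdm_states[OF assms(1)]] assms(2)
    by (auto intro!: mult_right_mono)
  finally show ?thesis .
qed

context ride_policy
begin

lemma mdp_advantage_bounded:
  obtains C where "C \<ge> 0" "\<And>x as. (x, as) \<in> mdp_pairs M \<Longrightarrow> \<bar>mdp_advantage M p x as\<bar> \<le> C"
proof -
  obtain C where C: "C \<ge> 0" "\<And>x a. (x, a) \<in> sdm_pairs M \<Longrightarrow> \<bar>advantage M p x a\<bar> \<le> C"
    by (rule advantage_bounded) blast
  show thesis
  proof
    show "real (num_cars M) * C \<ge> 0" using C by simp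
    fix x as assume "(x, as) \<in> mdp_pairs M"
    note x = mdp_pairsD[OF this]
    have "\<bar>mdp_advantage M p x as\<bar> \<le> real (length as) * C"
      unfolding mdp_advantage_eq_path_sum[OF x(3)]
      by (rule abs_path_sum_le[OF valid start_in_sdm_states[OF x(1)] x(4) C(2)])
    also have "\<dots> \<le> real (num_cars M) * C"
      using available_le_num_cars[OF start_in_sdm_states[OF x(1)]] x(3) C(1)
      by (intro mult_right_mono) auto
    finally show "\<bar>mdp_advantage M p x as\<bar> \<le> real (num_cars M) * C" .
  qed
qed

lemma advantage_le_SUP:
  assumes "(x, a) \<in> sdm_pairs M"
  shows "\<bar>advantage M p x a\<bar> \<le> (SUP (x, a)\<in>sdm_pairs M. \<bar>advantage M p x a\<bar>)"
proof -
  obtain C where "\<And>x a. (x, a) \<in> sdm_pairs M \<Longrightarrow> \<bar>advantage M p x a\<bar> \<le> C"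
    by (rule advantage_bounded) blast
  then have "bdd_above ((\<lambda>(x, a). \<bar>advantage M p x a\<bar>) ` sdm_pairs M)"
    by (auto intro!: bdd_aboveI2[of _ _ C])
  from cSUP_upper[OF assms this] show ?thesis by simp
qed

lemma mdp_advantage_le_SUP:
  assumes "(x, as) \<in> mdp_pairs M"
  shows "\<bar>mdp_advantage M p x as\<bar> \<le> (SUP (x, as)\<in>mdp_pairs M. \<bar>mdp_advantage M p x as\<bar>)"
proof -
  obtain C where "\<And>x as. (x, as) \<in> mdp_pairs M \<Longrightarrow> \<bar>mdp_advantage M p x as\<bar> \<le> C"
    by (rule mdp_advantage_bounded) blast
  then have "bdd_above ((\<lambda>(x, as). \<bar>mdp_advantage M p x as\<bar>) ` mdp_pairs M)"
    by (auto intro!: bdd_aboveI2[of _ _ C])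
  from cSUP_upper[OF assms this] show ?thesis by simp
qed

lemma expectation_path_sum:
  assumes "k = available M (start x)"
  shows "measure_pmf.expectation (epoch_actions M p x) (path_sum M g (start x))
    = (\<Sum>i<k. measure_pmf.expectation (sdm_law M p i (start x))
        (\<lambda>y. measure_pmf.expectation (p y) (g y)))"
proof -
  have finite_sdm_law: "finite (set_pmf (sdm_law M p i z))" for i z
    by (induction i arbitrary: z) (auto intro: finite_subset[OF subset_UNIV])
  have fin: "finite (set_pmf (sample_actions M p k (start x)))"
    by (rule finite_sample_actions)
  have "measure_pmf.expectation (epoch_actions M p x) (path_sum M g (start x))
      = measure_pmf.expectation (sample_actions M p k (start x))
          (\<lambda>as. \<Sum>i<k. g (foldl (atomic_step M) (start x) (take i as)) (as ! i))"
    unfolding epoch_actions_def assms[symmetric]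
    by (rule expectation_pmf_cong) (auto simp: path_sum_eq dest: length_sample_actions)
  also have "\<dots> = (\<Sum>i<k. measure_pmf.expectation (sample_actions M p k (start x))
          (\<lambda>as. g (foldl (atomic_step M) (start x) (take i as)) (as ! i)))"
    by (rule Bochner_Integration.integral_sum) (rule integrable_measure_pmf_finite[OF fin])
  also have "\<dots> = (\<Sum>i<k. measure_pmf.expectation (sdm_law M p i (start x))
        (\<lambda>y. measure_pmf.expectation (p y) (g y)))"
  proof (rule sum.cong[OF refl])
    fix i assume i: "i \<in> {..<k}"
    let ?J = "bind_pmf (sdm_law M p i (start x)) (\<lambda>y. map_pmf (Pair y) (p y))"
    have "finite (set_pmf ?J)"
      using finite_sdm_law by (auto intro: finite_subset[OF subset_UNIV])
    then obtain B where B: "\<And>z. z \<in> set_pmf ?J \<Longrightarrow> \<bar>(\<lambda>(y, a). g y a) z\<bar> \<le> B"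
      using finite_imp_bounded[OF finite_imageI, of "set_pmf ?J" "\<lambda>(y, a). g y a"]
      unfolding bounded_iff by fastforce
    have "measure_pmf.expectation (sample_actions M p k (start x))
          (\<lambda>as. g (foldl (atomic_step M) (start x) (take i as)) (as ! i))
        = measure_pmf.expectation (map_pmf (\<lambda>as. (foldl (atomic_step M) (start x) (take i as), as ! i))
            (sample_actions M p k (start x))) (\<lambda>(y, a). g y a)"
      by simp
    also have "\<dots> = measure_pmf.expectation ?J (\<lambda>(y, a). g y a)"
      using i by (subst map_sample_actions_state_action) auto
    also have "\<dots> = measure_pmf.expectation (sdm_law M p i (start x))
        (\<lambda>y. measure_pmf.expectation (p y) (g y))"
      by (subst expectation_bind_pmf_bounded[where B = B]) (use B in auto)
    finally show "measure_pmf.expectation (sample_actions M p k (start x))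
          (\<lambda>as. g (foldl (atomic_step M) (start x) (take i as)) (as ! i))
        = measure_pmf.expectation (sdm_law M p i (start x))
        (\<lambda>y. measure_pmf.expectation (p y) (g y))" .
  qed
  finally show ?thesis .
qed

end

text \<open>The roles in the theorem: \<open>p\<close> is \<open>\<pi>\<^sub>\<phi>\<close> and \<open>q\<close> is \<open>\<pi>\<^sub>\<theta>\<close>.\<close>

locale ride_policy_pair = ride_policy M p + target: ride_policy M q
  for M :: "('r::finite) ride_model" and p q :: "'r policy"
begin

definition epoch_gain :: "'r mdp_state \<Rightarrow> real" where
  "epoch_gain x = measure_pmf.expectation (epoch_actions M q x) (mdp_advantage M p x)"

lemma abs_epoch_gain_le_SUP:
  assumes "x \<in> mdp_states M" "epoch x \<le> horizon M"
  shows "\<bar>epoch_gain x\<bar> \<le> (SUP (x, as)\<in>mdp_pairs M. \<bar>mdp_advantage M p x as\<bar>)"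
  unfolding epoch_gain_def
  by (intro abs_expectation_pmf_le mdp_advantage_le_SUP target.epoch_actions_pairs[OF assms])

lemma epoch_gain_eq_path_sum:
  "epoch_gain x = measure_pmf.expectation (epoch_actions M q x) (path_sum M (advantage M p) (start x))"
  unfolding epoch_gain_def
  by (rule expectation_pmf_cong)
    (auto simp: epoch_actions_def mdp_advantage_eq_path_sum dest: length_sample_actions)

lemma value_fun_diff_step:
  assumes x: "x \<in> mdp_states M" "epoch x \<le> horizon M"
  shows "value_fun M q (start x) - value_fun M p (start x)
    = epoch_gain x + measure_pmf.expectation (bind_pmf (epoch_actions M q x) (epoch_step M x))
        (\<lambda>y. value_fun M q (start y) - value_fun M p (start y))"
proof -
  obtain C where C: "\<And>x. x \<in> sdm_states M \<Longrightarrow> \<bar>value_fun M p x\<bar> \<le> C"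
    by (rule value_fun_bounded) blast
  obtain D where D: "\<And>x. x \<in> sdm_states M \<Longrightarrow> \<bar>value_fun M q x\<bar> \<le> D"
    by (rule target.value_fun_bounded) blast
  let ?A = "epoch_actions M q x"
  let ?end = "\<lambda>as. foldl (atomic_step M) (start x) as"
  let ?reward = "path_sum M (reward M) (start x)"
  let ?V = "value_fun M p (start x)"
  have sx: "start x \<in> sdm_states M" "epoch (start x) \<le> horizon M"
    using x by (auto simp: start_in_sdm_states)
  have int: "integrable (measure_pmf ?A) f" for f :: "_ \<Rightarrow> real"
    unfolding epoch_actions_def by (rule integrable_measure_pmf_finite[OF target.finite_sample_actions])
  have states: "start y \<in> sdm_states M"
    if "as \<in> set_pmf ?A" "y \<in> set_pmf (epoch_step M x as)" for as y
    using epoch_step_states(1)[OF valid target.epoch_actions_pairs[OF x that(1)] that(2)]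
    by (rule start_in_sdm_states)
  have "epoch_gain x = measure_pmf.expectation ?A (\<lambda>as. ?reward as + continuation (?end as) - ?V)"
    unfolding epoch_gain_eq_path_sum
  proof (rule expectation_pmf_cong)
    fix as assume "as \<in> set_pmf ?A"
    note as = mdp_pairsD[OF target.epoch_actions_pairs[OF x this]]
    show "path_sum M (advantage M p) (start x) as = ?reward as + continuation (?end as) - ?V"
      by (rule path_sum_advantage[OF sx as(4,3)])
  qed
  also have "\<dots> = measure_pmf.expectation ?A (\<lambda>as. ?reward as + continuation (?end as)) - ?V"
    by (simp add: Bochner_Integration.integral_diff[OF int int])
  finally have gain: "measure_pmf.expectation ?A (\<lambda>as. ?reward as + continuation (?end as))
      = epoch_gain x + ?V"
    by simp
  have "value_fun M q (start x)
      = measure_pmf.expectation ?A (\<lambda>as. ?reward as + target.continuation (?end as))"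
    unfolding target.value_fun_rec[OF sx] epoch_actions_def ..
  also have "\<dots> = measure_pmf.expectation ?A (\<lambda>as. (?reward as + continuation (?end as))
      + (target.continuation (?end as) - continuation (?end as)))"
    by (simp add: algebra_simps)
  also have "\<dots> = epoch_gain x + ?V
      + measure_pmf.expectation ?A (\<lambda>as. target.continuation (?end as) - continuation (?end as))"
    unfolding gain[symmetric] by (rule Bochner_Integration.integral_add[OF int int])
  also have "measure_pmf.expectation ?A (\<lambda>as. target.continuation (?end as) - continuation (?end as))
      = measure_pmf.expectation ?A (\<lambda>as. measure_pmf.expectation (epoch_step M x as)
        (\<lambda>y. value_fun M q (start y) - value_fun M p (start y)))"
  proof (rule expectation_pmf_cong)
    fix as assume as: "as \<in> set_pmf ?A"
    show "target.continuation (?end as) - continuation (?end as)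
        = measure_pmf.expectation (epoch_step M x as)
          (\<lambda>y. value_fun M q (start y) - value_fun M p (start y))"
      unfolding target.continuation_def continuation_def epoch_step_def[symmetric]
      by (rule Bochner_Integration.integral_diff[symmetric]; rule integrable_measure_pmf_bounded)
        (use C D states[OF as] in blast)+
  qed
  also have "\<dots> = measure_pmf.expectation (bind_pmf ?A (epoch_step M x))
        (\<lambda>y. value_fun M q (start y) - value_fun M p (start y))"
  proof (rule expectation_bind_pmf_bounded[symmetric])
    fix y assume "y \<in> set_pmf (bind_pmf ?A (epoch_step M x))"
    then have "start y \<in> sdm_states M"
      using states by auto
    then show "\<bar>value_fun M q (start y) - value_fun M p (start y)\<bar> \<le> C + D"
      using C[of "start y"] D[of "start y"] by linarith
  qed
  finally show ?thesis by simp
qed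

lemma performance_difference:
  assumes "x \<in> mdp_states M" "epoch x + n = horizon M + 1"
  shows "value_fun M q (start x) - value_fun M p (start x)
    = (\<Sum>t<n. measure_pmf.expectation (epoch_law M q t x) epoch_gain)"
  using assms
proof (induction n arbitrary: x)
  case 0
  then show ?case
    by (simp add: value_fun_def)
next
  case (Suc n)
  let ?P = "bind_pmf (epoch_actions M q x) (epoch_step M x)"
  let ?A = "SUP (x, as)\<in>mdp_pairs M. \<bar>mdp_advantage M p x as\<bar>"
  have x: "epoch x \<le> horizon M"
    using Suc.prems by simp
  have next_states: "y \<in> mdp_states M \<and> epoch y + n = horizon M + 1" if "y \<in> set_pmf ?P" for y
    using that epoch_step_states[OF valid target.epoch_actions_pairs[OF Suc.prems(1) x]] Suc.prems(2)
    by fastforce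
  have bd: "\<bar>epoch_gain z\<bar> \<le> ?A"
    if "y \<in> set_pmf ?P" "t < n" "z \<in> set_pmf (epoch_law M q t y)" for y t z
    using target.epoch_law_states[OF _ _ that(3)] next_states[OF that(1)] that(2)
    by (intro abs_epoch_gain_le_SUP) auto
  have "value_fun M q (start x) - value_fun M p (start x)
      = epoch_gain x + measure_pmf.expectation ?P
          (\<lambda>y. \<Sum>t<n. measure_pmf.expectation (epoch_law M q t y) epoch_gain)"
    unfolding value_fun_diff_step[OF Suc.prems(1) x]
    by (rule arg_cong[where f = "(+) _"], rule expectation_pmf_cong, rule Suc.IH)
      (use next_states in blast)+
  also have "measure_pmf.expectation ?P
          (\<lambda>y. \<Sum>t<n. measure_pmf.expectation (epoch_law M q t y) epoch_gain)
      = (\<Sum>t<n. measure_pmf.expectation ?P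
          (\<lambda>y. measure_pmf.expectation (epoch_law M q t y) epoch_gain))"
    by (intro Bochner_Integration.integral_sum integrable_measure_pmf_bounded[where B = ?A]
        abs_expectation_pmf_le bd) auto
  also have "\<dots> = (\<Sum>t<n. measure_pmf.expectation (epoch_law M q (Suc t) x) epoch_gain)"
  proof (rule sum.cong[OF refl])
    fix t assume "t \<in> {..<n}"
    then show "measure_pmf.expectation ?P (\<lambda>y. measure_pmf.expectation (epoch_law M q t y) epoch_gain)
        = measure_pmf.expectation (epoch_law M q (Suc t) x) epoch_gain"
      unfolding epoch_law.simps(2)
      by (intro expectation_bind_pmf_bounded[where B = ?A, symmetric]) (use bd in fastforce)
  qed
  finally show ?case
    by (simp add: sum.lessThan_Suc_shift del: sum.lessThan_Suc epoch_law.simps(2))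
qed

end

section \<open>The improvement bound\<close>

context ride_policy_pair
begin

definition dominated :: "'r sdm_state \<Rightarrow> bool" where
  "dominated y \<longleftrightarrow> (\<forall>a. pmf (p y) a = 0 \<longrightarrow> pmf (q y) a = 0)"

definition weighted_advantage :: "'r sdm_state \<Rightarrow> 'r action \<Rightarrow> real" where
  "weighted_advantage y a = pmf (q y) a / pmf (p y) a * advantage M p y a"

definition sdm_distance :: "'r mdp_state \<Rightarrow> real" where
  "sdm_distance x = (\<Sum>i<available M (start x). \<Sum>\<^sub>\<infinity>y\<in>sdm_states M.
     \<bar>pmf (sdm_law M p i (start x)) y - pmf (sdm_law M q i (start x)) y\<bar>)"

lemma expectation_importance:
  assumes "dominated y"
  shows "measure_pmf.expectation (p y) (\<lambda>a. pmf (q y) a / pmf (p y) a * g a)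
    = measure_pmf.expectation (q y) g"
proof -
  have "pmf (q y) a / pmf (p y) a * g a * pmf (p y) a = g a * pmf (q y) a" for a
    using assms[unfolded dominated_def, rule_format, of a] by (cases "pmf (p y) a = 0") simp_all
  then show ?thesis
    by (simp add: integral_measure_pmf_real[of UNIV])
qed

context
  fixes x :: "'r mdp_state"
  assumes x: "x \<in> mdp_states M" "epoch x \<le> horizon M"
    and dominated: "\<And>i y. i < available M (start x) \<Longrightarrow> y \<in> set_pmf (sdm_law M p i (start x)) \<Longrightarrow>
      dominated y"
begin

lemma start_state: "start x \<in> sdm_states M" "epoch (start x) \<le> horizon M"
  using x by (auto simp: start_in_sdm_states)

lemma base_state_target_pairs:
  assumes "i < available M (start x)" "y \<in> set_pmf (sdm_law M p i (start x))" "a \<in> set_pmf (q y)"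
  shows "(y, a) \<in> sdm_pairs M"
  using sdm_law_states[OF start_state assms(1,2)] assms(1,3) target.policy_feasible[of y a] x(2)
  by (simp add: sdm_pairs_def)

lemma expectation_weighted_path_sum:
  "measure_pmf.expectation (epoch_actions M p x)
      (path_sum M (\<lambda>y a. pmf (q y) a / pmf (p y) a * g y a) (start x))
    = (\<Sum>i<available M (start x). measure_pmf.expectation (sdm_law M p i (start x))
        (\<lambda>y. measure_pmf.expectation (q y) (g y)))"
  unfolding expectation_path_sum[OF refl]
  by (intro sum.cong refl expectation_pmf_cong expectation_importance dominated) auto

lemma integrable_epoch_actions:
  "integrable (measure_pmf (epoch_actions M p x)) (f :: _ \<Rightarrow> real)"
  unfolding epoch_actions_def by (rule integrable_measure_pmf_finite[OF finite_sample_actions])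

lemma expectation_weighted_advantage_bounded:
  assumes C: "C \<ge> 0" "\<And>y a. (y, a) \<in> sdm_pairs M \<Longrightarrow> \<bar>advantage M p y a\<bar> \<le> C"
  shows "measure_pmf.expectation (epoch_actions M p x)
      (\<lambda>as. \<bar>path_sum M weighted_advantage (start x) as\<bar>) \<le> real (num_cars M) * C"
proof -
  have "measure_pmf.expectation (epoch_actions M p x)
      (\<lambda>as. \<bar>path_sum M weighted_advantage (start x) as\<bar>)
    \<le> measure_pmf.expectation (epoch_actions M p x)
      (path_sum M (\<lambda>y a. pmf (q y) a / pmf (p y) a * \<bar>advantage M p y a\<bar>) (start x))"
  proof (rule expectation_pmf_mono[OF integrable_epoch_actions integrable_epoch_actions])
    fix as
    show "\<bar>path_sum M weighted_advantage (start x) as\<bar>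
      \<le> path_sum M (\<lambda>y a. pmf (q y) a / pmf (p y) a * \<bar>advantage M p y a\<bar>) (start x) as"
      unfolding path_sum_def weighted_advantage_def
      by (rule order_trans[OF sum_abs sum_mono]) (simp add: abs_mult)
  qed
  also have "\<dots> \<le> real (num_cars M) * C"
    unfolding expectation_weighted_path_sum
    by (intro order_trans[OF abs_ge_self sum_available_le[OF x(1) C(1)]] abs_expectation_pmf_le)
      (simp add: C(2) base_state_target_pairs)
  finally show ?thesis .
qed

lemma weighted_gain_bounded:
  assumes C: "C \<ge> 0" "\<And>y a. (y, a) \<in> sdm_pairs M \<Longrightarrow> \<bar>advantage M p y a\<bar> \<le> C"
  shows "\<bar>measure_pmf.expectation (epoch_actions M p x) (path_sum M weighted_advantage (start x))\<bar>
    \<le> real (num_cars M) * C"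
  by (rule order_trans[OF integral_abs_bound expectation_weighted_advantage_bounded[OF C]])

lemma epoch_gain_lower_bound:
  "measure_pmf.expectation (epoch_actions M p x) (path_sum M weighted_advantage (start x))
      - (SUP (x, a)\<in>sdm_pairs M. \<bar>advantage M p x a\<bar>) * sdm_distance x
    \<le> epoch_gain x"
proof -
  let ?A = "SUP (x, a)\<in>sdm_pairs M. \<bar>advantage M p x a\<bar>"
  let ?b = "\<lambda>y. measure_pmf.expectation (q y) (advantage M p y)"
  let ?d = "\<lambda>i. \<Sum>\<^sub>\<infinity>y\<in>sdm_states M.
     \<bar>pmf (sdm_law M p i (start x)) y - pmf (sdm_law M q i (start x)) y\<bar>"
  have "measure_pmf.expectation (epoch_actions M p x) (path_sum M weighted_advantage (start x))
      - ?A * sdm_distance x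
    = (\<Sum>i<available M (start x). measure_pmf.expectation (sdm_law M p i (start x)) ?b - ?A * ?d i)"
    using expectation_weighted_path_sum[of "advantage M p"]
    unfolding weighted_advantage_def[abs_def] sdm_distance_def sum_subtractf sum_distrib_left
    by simp
  also have "\<dots> \<le> (\<Sum>i<available M (start x). measure_pmf.expectation (sdm_law M q i (start x)) ?b)"
  proof (rule sum_mono)
    fix i assume "i \<in> {..<available M (start x)}"
    then have i: "i < available M (start x)" by simp
    show "measure_pmf.expectation (sdm_law M p i (start x)) ?b - ?A * ?d i
        \<le> measure_pmf.expectation (sdm_law M q i (start x)) ?b"
    proof (rule expectation_pmf_change)
      show "set_pmf (sdm_law M q i (start x)) \<subseteq> sdm_states M"
        "set_pmf (sdm_law M p i (start x)) \<subseteq> sdm_states M"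
        using sdm_law_states(1)[OF start_state i] target.sdm_law_states(1)[OF start_state i] by auto
      fix y assume "y \<in> set_pmf (sdm_law M q i (start x)) \<union> set_pmf (sdm_law M p i (start x))"
      then have "(y, a) \<in> sdm_pairs M" if "a \<in> set_pmf (q y)" for a
        using that target.sdm_law_pairs[OF start_state i] base_state_target_pairs[OF i] by blast
      then show "\<bar>?b y\<bar> \<le> ?A"
        by (intro abs_expectation_pmf_le advantage_le_SUP)
    qed
  qed
  also have "\<dots> = epoch_gain x"
    unfolding epoch_gain_eq_path_sum target.expectation_path_sum[OF refl] ..
  finally show ?thesis .
qed

end

lemma sdm_distance_bounded:
  assumes "x \<in> mdp_states M"
  shows "\<bar>sdm_distance x\<bar> \<le> real (num_cars M) * 2"
  unfolding sdm_distance_def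
  by (rule sum_available_le[OF assms]) (simp_all add: infsum_nonneg infsum_abs_pmf_diff_le)

end

lemma state_action_in_run:
  assumes "t < n" "x \<in> set_pmf (epoch_law M p t x1)" "as \<in> set_pmf (epoch_actions M p x)"
  obtains \<omega> where "\<omega> \<in> set_pmf (run M p n (start x1))" "\<omega> ! t = (start x, as)"
proof -
  have "(start x, as) \<in> set_pmf (map_pmf (\<lambda>\<omega>. \<omega> ! t) (run M p n (start x1)))"
    unfolding map_run_nth[OF assms(1)] using assms(2,3) by auto
  with that show thesis by auto
qed

locale policy_improvement = ride_policy_pair M p q
  for M :: "('r::finite) ride_model" and p q :: "'r policy" +
  fixes x1 :: "'r mdp_state"
  assumes x1: "x1 \<in> mdp_states M" "epoch x1 = 1"
    and dominated_run: "\<And>\<omega> t i a. \<omega> \<in> set_pmf (run M p (horizon M) (start x1)) \<Longrightarrow>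
           t \<in> {1..horizon M} \<Longrightarrow> i \<in> {1..traj_steps M \<omega> t} \<Longrightarrow>
           pmf (p (traj_state M \<omega> t i)) a = 0 \<Longrightarrow> pmf (q (traj_state M \<omega> t i)) a = 0"
begin

abbreviation weighted_gain :: "'r mdp_state \<Rightarrow> real" where
  "weighted_gain x \<equiv>
     measure_pmf.expectation (epoch_actions M p x) (path_sum M weighted_advantage (start x))"

lemma visited_states:
  assumes "t < horizon M" "x \<in> set_pmf (epoch_law M p t x1)"
  shows "x \<in> mdp_states M" "epoch x = Suc t" "epoch x \<le> horizon M"
  using epoch_law_states[OF x1(1) _ assms(2)] assms(1) x1(2) by auto

lemma visited_dominated:
  assumes t: "t < horizon M" and x: "x \<in> set_pmf (epoch_law M p t x1)"
    and i: "i < available M (start x)" and y: "y \<in> set_pmf (sdm_law M p i (start x))"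
  shows "dominated y"
proof -
  obtain as where as: "as \<in> set_pmf (epoch_actions M p x)"
    and y: "y = foldl (atomic_step M) (start x) (take i as)"
    using i y by (auto simp: epoch_actions_def simp flip: map_sample_actions_state)
  obtain \<omega> where \<omega>: "\<omega> \<in> set_pmf (run M p (horizon M) (start x1))" "\<omega> ! t = (start x, as)"
    by (rule state_action_in_run[OF t x as])
  have "traj_state M \<omega> (Suc t) (Suc i) = y" "Suc i \<in> {1..traj_steps M \<omega> (Suc t)}"
    using \<omega>(2) i by (simp_all add: traj_state_def traj_start_def traj_steps_def sdm_at_def y)
  then show ?thesis
    using dominated_run[OF \<omega>(1), of "Suc t" "Suc i"] t by (auto simp: dominated_def)
qed

lemma expectation_run_eq:
  "measure_pmf.expectation (run M p (horizon M) (start x1))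
     (\<lambda>\<omega>. \<Sum>t=1..horizon M. \<Sum>i=1..traj_steps M \<omega> t.
        weighted_advantage (traj_state M \<omega> t i) (traj_action \<omega> t i))
   = (\<Sum>t<horizon M. measure_pmf.expectation (epoch_law M p t x1) weighted_gain)"
proof -
  obtain C where C: "C \<ge> 0" "\<And>y a. (y, a) \<in> sdm_pairs M \<Longrightarrow> \<bar>advantage M p y a\<bar> \<le> C"
    by (rule advantage_bounded) blast
  let ?run = "run M p (horizon M) (start x1)"
  let ?w = "\<lambda>(s, as). \<Sum>i=1..available M s. weighted_advantage (sdm_at M s as i) (as ! (i - 1))"
  let ?J = "\<lambda>x. map_pmf (Pair (start x)) (epoch_actions M p x)"
  have w: "?w (start x, as) = path_sum M weighted_advantage (start x) as"
    if "as \<in> set_pmf (epoch_actions M p x)" for x as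
    using length_sample_actions that by (fastforce simp: epoch_actions_def path_sum_def)
  have each: "integrable (measure_pmf ?run) (\<lambda>\<omega>. ?w (\<omega> ! t))
      \<and> measure_pmf.expectation ?run (\<lambda>\<omega>. ?w (\<omega> ! t))
        = measure_pmf.expectation (epoch_law M p t x1) weighted_gain"
    if t: "t < horizon M" for t
  proof -
    have int: "integrable (measure_pmf (?J x)) ?w" for x
      unfolding epoch_actions_def
      by (rule integrable_measure_pmf_finite) (simp add: finite_sample_actions)
    have bd: "measure_pmf.expectation (?J x) (\<lambda>z. \<bar>?w z\<bar>) \<le> real (num_cars M) * C"
      if x: "x \<in> set_pmf (epoch_law M p t x1)" for x
    proof -
      have "measure_pmf.expectation (?J x) (\<lambda>z. \<bar>?w z\<bar>)
          = measure_pmf.expectation (epoch_actions M p x)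
              (\<lambda>as. \<bar>path_sum M weighted_advantage (start x) as\<bar>)"
        unfolding integral_map_pmf by (rule expectation_pmf_cong) (simp only: w)
      also have "\<dots> \<le> real (num_cars M) * C"
        by (rule expectation_weighted_advantage_bounded[OF visited_states(1,3)[OF t x] visited_dominated[OF t x] C])
      finally show ?thesis .
    qed
    have "integrable (measure_pmf (map_pmf (\<lambda>\<omega>. \<omega> ! t) ?run)) ?w"
      unfolding map_run_nth[OF t] by (rule integrable_bind_pmf[OF int bd])
    moreover have "measure_pmf.expectation (map_pmf (\<lambda>\<omega>. \<omega> ! t) ?run) ?w
        = measure_pmf.expectation (epoch_law M p t x1) (\<lambda>x. measure_pmf.expectation (?J x) ?w)"
      unfolding map_run_nth[OF t] by (rule expectation_bind_pmf[OF int bd])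
    moreover have "measure_pmf.expectation (?J x) ?w = weighted_gain x" for x
      unfolding integral_map_pmf by (rule expectation_pmf_cong) (simp only: w)
    ultimately show ?thesis
      by simp
  qed
  have "measure_pmf.expectation ?run
     (\<lambda>\<omega>. \<Sum>t=1..horizon M. \<Sum>i=1..traj_steps M \<omega> t.
        weighted_advantage (traj_state M \<omega> t i) (traj_action \<omega> t i))
    = measure_pmf.expectation ?run (\<lambda>\<omega>. \<Sum>t<horizon M. ?w (\<omega> ! t))"
    by (simp add: sum.atLeast1_atMost_eq traj_steps_def traj_state_def traj_action_def traj_start_def
        case_prod_beta)
  also have "\<dots> = (\<Sum>t<horizon M. measure_pmf.expectation ?run (\<lambda>\<omega>. ?w (\<omega> ! t)))"
    by (rule Bochner_Integration.integral_sum) (use each in auto)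
  also have "\<dots> = (\<Sum>t<horizon M. measure_pmf.expectation (epoch_law M p t x1) weighted_gain)"
    using each by (intro sum.cong) auto
  finally show ?thesis .
qed

lemma expectation_sdm_distance:
  assumes t: "t < horizon M"
  shows "measure_pmf.expectation (epoch_law M p t x1) sdm_distance
    = (\<Sum>\<^sub>\<infinity>x\<in>mdp_states M. occ_mdp M p x1 (Suc t) x
         * (\<Sum>i=1..available M (start x). \<Sum>\<^sub>\<infinity>y\<in>sdm_states M.
              \<bar>occ_sdm M p (Suc t) i x y - occ_sdm M q (Suc t) i x y\<bar>))"
proof -
  let ?law = "epoch_law M p t x1"
  have sub: "set_pmf ?law \<subseteq> mdp_states M"
    using visited_states(1)[OF t] by auto
  have "integrable (measure_pmf ?law) sdm_distance"
    by (rule integrable_measure_pmf_bounded, rule sdm_distance_bounded) (use sub in auto)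
  then have "measure_pmf.expectation ?law sdm_distance
      = (\<Sum>\<^sub>\<infinity>x\<in>mdp_states M. pmf ?law x * sdm_distance x)"
    by (intro infsumI[symmetric] has_sum_expectation_pmf[OF _ sub])
  also have "\<dots> = (\<Sum>\<^sub>\<infinity>x\<in>mdp_states M. occ_mdp M p x1 (Suc t) x
         * (\<Sum>i=1..available M (start x). \<Sum>\<^sub>\<infinity>y\<in>sdm_states M.
              \<bar>occ_sdm M p (Suc t) i x y - occ_sdm M q (Suc t) i x y\<bar>))"
  proof (rule infsum_cong)
    fix x
    have occ: "occ_mdp M p x1 (Suc t) x = pmf ?law x"
      using t by (simp add: occ_mdp_eq_pmf)
    show "pmf ?law x * sdm_distance x = occ_mdp M p x1 (Suc t) x
         * (\<Sum>i=1..available M (start x). \<Sum>\<^sub>\<infinity>y\<in>sdm_states M.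
              \<bar>occ_sdm M p (Suc t) i x y - occ_sdm M q (Suc t) i x y\<bar>)"
    proof (cases "x \<in> set_pmf ?law")
      case True
      then have "epoch x = Suc t"
        by (rule visited_states(2)[OF t])
      then have "sdm_distance x = (\<Sum>i=1..available M (start x). \<Sum>\<^sub>\<infinity>y\<in>sdm_states M.
              \<bar>occ_sdm M p (Suc t) i x y - occ_sdm M q (Suc t) i x y\<bar>)"
        unfolding sdm_distance_def One_nat_def sum.atLeast1_atMost_eq
        by (intro sum.cong infsum_cong refl) (simp add: occ_sdm_eq_pmf)
      then show ?thesis
        by (simp add: occ)
    next
      case False
      then show ?thesis
        by (simp add: occ set_pmf_iff)
    qed
  qed
  finally show ?thesis .
qed

lemma policy_improvement_bound:
  "value_fun M q (start x1) - value_fun M p (start x1) \<ge>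
      measure_pmf.expectation (run M p (horizon M) (start x1))
        (\<lambda>\<omega>. \<Sum>t=1..horizon M. \<Sum>i=1..traj_steps M \<omega> t.
           weighted_advantage (traj_state M \<omega> t i) (traj_action \<omega> t i))
      - (SUP (x, a)\<in>sdm_pairs M. \<bar>advantage M p x a\<bar>)
        * (\<Sum>t=1..horizon M. \<Sum>\<^sub>\<infinity>x\<in>mdp_states M. occ_mdp M p x1 t x
             * (\<Sum>i=1..available M (start x). \<Sum>\<^sub>\<infinity>y\<in>sdm_states M.
                  \<bar>occ_sdm M p t i x y - occ_sdm M q t i x y\<bar>))
      - (SUP (x, as)\<in>mdp_pairs M. \<bar>mdp_advantage M p x as\<bar>)
        * (\<Sum>t=1..horizon M. \<Sum>\<^sub>\<infinity>x\<in>mdp_states M.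
             \<bar>occ_mdp M p x1 t x - occ_mdp M q x1 t x\<bar>)"
proof -
  obtain C where C: "C \<ge> 0" "\<And>y a. (y, a) \<in> sdm_pairs M \<Longrightarrow> \<bar>advantage M p y a\<bar> \<le> C"
    by (rule advantage_bounded) blast
  let ?A = "SUP (x, a)\<in>sdm_pairs M. \<bar>advantage M p x a\<bar>"
  let ?B = "SUP (x, as)\<in>mdp_pairs M. \<bar>mdp_advantage M p x as\<bar>"
  let ?E = "\<lambda>t. measure_pmf.expectation (epoch_law M p t x1)"
  let ?D = "\<lambda>t. \<Sum>\<^sub>\<infinity>x\<in>mdp_states M. \<bar>occ_mdp M p x1 (Suc t) x - occ_mdp M q x1 (Suc t) x\<bar>"
  have step: "?E t weighted_gain - ?A * ?E t sdm_distance - ?B * ?D t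
      \<le> measure_pmf.expectation (epoch_law M q t x1) epoch_gain" if t: "t < horizon M" for t
  proof -
    have q_states: "x \<in> mdp_states M \<and> epoch x \<le> horizon M"
      if "x \<in> set_pmf (epoch_law M q t x1)" for x
      using target.epoch_law_states[OF x1(1) _ that] t x1(2) by auto
    have int_w: "integrable (measure_pmf (epoch_law M p t x1)) weighted_gain"
      by (rule integrable_measure_pmf_bounded, rule weighted_gain_bounded[OF visited_states(1,3)[OF t] visited_dominated[OF t] C])
    have int_d: "integrable (measure_pmf (epoch_law M p t x1)) sdm_distance"
      by (rule integrable_measure_pmf_bounded, rule sdm_distance_bounded, rule visited_states(1)[OF t])
    have int_g: "integrable (measure_pmf (epoch_law M p t x1)) epoch_gain"
      by (rule integrable_measure_pmf_bounded, rule abs_epoch_gain_le_SUP) (rule visited_states[OF t], assumption)+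
    have "?E t weighted_gain - ?A * ?E t sdm_distance
        = ?E t (\<lambda>x. weighted_gain x - ?A * sdm_distance x)"
      using int_w int_d by simp
    also have "\<dots> \<le> ?E t epoch_gain"
      by (rule expectation_pmf_mono)
        (use int_w int_d int_g epoch_gain_lower_bound[OF visited_states(1,3)[OF t] visited_dominated[OF t]] in auto)
    finally have "?E t weighted_gain - ?A * ?E t sdm_distance \<le> ?E t epoch_gain" .
    moreover have "?E t epoch_gain - ?B * ?D t \<le> measure_pmf.expectation (epoch_law M q t x1) epoch_gain"
    proof -
      have occ: "?D t = (\<Sum>\<^sub>\<infinity>x\<in>mdp_states M. \<bar>pmf (epoch_law M p t x1) x - pmf (epoch_law M q t x1) x\<bar>)"
        using t by (simp add: occ_mdp_eq_pmf)
      show ?thesis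
        unfolding occ
        by (rule expectation_pmf_change)
          (use q_states visited_states[OF t] in \<open>auto intro!: abs_epoch_gain_le_SUP\<close>)
    qed
    ultimately show ?thesis by linarith
  qed
  have "(\<Sum>t<horizon M. ?E t weighted_gain - ?A * ?E t sdm_distance - ?B * ?D t)
      \<le> (\<Sum>t<horizon M. measure_pmf.expectation (epoch_law M q t x1) epoch_gain)"
    by (rule sum_mono) (use step in simp)
  also have "\<dots> = value_fun M q (start x1) - value_fun M p (start x1)"
    using performance_difference[OF x1(1), of "horizon M"] x1(2) by simp
  also have "(\<Sum>t<horizon M. ?E t weighted_gain - ?A * ?E t sdm_distance - ?B * ?D t)
      = (\<Sum>t<horizon M. ?E t weighted_gain) - ?A * (\<Sum>t<horizon M. ?E t sdm_distance)
        - ?B * (\<Sum>t<horizon M. ?D t)"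
    by (simp add: sum_subtractf sum_distrib_left)
  finally show ?thesis
    unfolding expectation_run_eq
    unfolding One_nat_def sum.atLeast1_atMost_eq[of _ "horizon M"]
    by (simp add: expectation_sdm_distance)
qed

end

theorem theorem2:
  fixes M :: "('r::finite) ride_model"
    and \<Theta> :: "(real ^ 'd) set"
    and \<pi> :: "real ^ 'd \<Rightarrow> 'r policy"
    and \<theta> \<phi> :: "real ^ 'd"
    and x1 :: "'r mdp_state"
  assumes "valid_model M"
    and "open \<Theta>"
    and "\<And>\<psi>. \<psi> \<in> \<Theta> \<Longrightarrow> admissible_policy M (\<pi> \<psi>)"
    and "\<theta> \<in> \<Theta>" and "\<phi> \<in> \<Theta>"
    and "x1 \<in> mdp_states M" and "epoch x1 = 1"
    \<comment> \<open>the likelihood ratio is defined at the states visited under \<open>\<pi>\<^sub>\<phi>\<close>\<close>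
    and "\<And>\<omega> t i a. \<omega> \<in> set_pmf (run M (\<pi> \<phi>) (horizon M) (start x1)) \<Longrightarrow>
           t \<in> {1..horizon M} \<Longrightarrow> i \<in> {1..traj_steps M \<omega> t} \<Longrightarrow>
           pmf (\<pi> \<phi> (traj_state M \<omega> t i)) a = 0 \<Longrightarrow> pmf (\<pi> \<theta> (traj_state M \<omega> t i)) a = 0"
  shows "value_fun M (\<pi> \<theta>) (start x1) - value_fun M (\<pi> \<phi>) (start x1) \<ge>
      measure_pmf.expectation (run M (\<pi> \<phi>) (horizon M) (start x1))
        (\<lambda>\<omega>. \<Sum>t=1..horizon M. \<Sum>i=1..traj_steps M \<omega> t.
           pmf (\<pi> \<theta> (traj_state M \<omega> t i)) (traj_action \<omega> t i)
             / pmf (\<pi> \<phi> (traj_state M \<omega> t i)) (traj_action \<omega> t i)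
           * advantage M (\<pi> \<phi>) (traj_state M \<omega> t i) (traj_action \<omega> t i))
      - (SUP (x, a)\<in>sdm_pairs M. \<bar>advantage M (\<pi> \<phi>) x a\<bar>)
        * (\<Sum>t=1..horizon M. \<Sum>\<^sub>\<infinity>x\<in>mdp_states M. occ_mdp M (\<pi> \<phi>) x1 t x
             * (\<Sum>i=1..available M (start x). \<Sum>\<^sub>\<infinity>y\<in>sdm_states M.
                  \<bar>occ_sdm M (\<pi> \<phi>) t i x y - occ_sdm M (\<pi> \<theta>) t i x y\<bar>))
      - (SUP (x, as)\<in>mdp_pairs M. \<bar>mdp_advantage M (\<pi> \<phi>) x as\<bar>)
        * (\<Sum>t=1..horizon M. \<Sum>\<^sub>\<infinity>x\<in>mdp_states M.
             \<bar>occ_mdp M (\<pi> \<phi>) x1 t x - occ_mdp M (\<pi> \<theta>) x1 t x\<bar>)"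
proof -
  interpret policy_improvement M "\<pi> \<phi>" "\<pi> \<theta>" x1
    by unfold_locales (use assms in blast)+
  show ?thesis
    using policy_improvement_bound unfolding weighted_advantage_def .
qed

end
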